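(* Let $\Sigma =\overline{\mathbf{C}} \setminus \{0, \mathrm{i}, -\mathrm{i}, \infty \}$, let $a, b \in \mathbf{R}\setminus\{ 1 \}$ with $a\neq b$, and let $\sigma$ satisfy $$\sigma^{2} = \frac{5a+11b-16}{16ab-11a-5b}, \qquad \sigma^2<0 \quad(\text{i.e. } \sigma\in \mathrm{i}\mathbf{R}).$$ Define on $\Sigma$ $$g(z) = \sigma\, \frac{(b-a)z^4 +4a(b-1)z^2 +4a(b-1)}{(b-a)z^4 +4(b-1)z^2 +4(b-1)}, \qquad h\,dz = \frac{\{(b-a)z^4 +4(b-1)z^2 +4(b-1)\}^{2}}{z^2(z^2+1)^{2}}\, dz .$$ Then there is a complete minimal surface $X\colon \Sigma \to \mathbf{R}^3$ whose Weierstrass data is $(g, h\,dz)$. In particular, this surface has finite total curvature, and the total weight $\nu_g$ of the totally ramified values of its Gauss map $g\colon\Sigma\to\overline{\mathbf{C}}$ is $\nu_{g}= 5/2$.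
   Context: $\overline{\mathbf{C}}=\mathbf{C}\cup\{\infty\}$ is the Riemann sphere and $\mathrm{i}=\sqrt{-1}$. Weierstrass data in $\mathbf{R}^3$: given a meromorphic function $g$ and a holomorphic differential $h\,dz$ on a Riemann surface $\Sigma$, put $$\phi_1=\tfrac12(1-g^2)h\,dz,\quad \phi_2=\tfrac{\mathrm{i}}2(1+g^2)h\,dz,\quad \phi_3=g\,h\,dz .$$ The pair $(g,h\,dz)$ is the Weierstrass data of a minimal surface $X\colon\Sigma\to\mathbf{R}^3$ if $\phi_1,\phi_2,\phi_3$ are holomorphic without common zeros (equivalently, the zeros of $h\,dz$ are exactly the poles of $g$, with a zero of order $2s$ at each pole of order $s$), $\mathrm{Re}\int_c\phi_i=0$ for $i=1,2,3$ and every cycle $c\in H_1(\Sigma,\mathbf{Z})$, and, up to translation, $X(z)=\mathrm{Re}\left(\int_{z_0}^z 2\phi_1,\int_{z_0}^z 2\phi_2,\int_{z_0}^z 2\phi_3\right)$ for a fixed $z_0\in\Sigma$. Then $g$ is the Gauss map of $X$ (composed with stereographic projection $S^2\to\overline{\mathbf{C}}$), and the induced metric is $ds^2=(1+|g|^2)^2|h|^2|dz|^2$. The surface is complete if all divergent paths in $\Sigma$ have infinite length with respect to $ds^2$. The total curvature is $\int_\Sigma K\,dA$, where $K$ is the Gauss curvature and $dA$ the area element of $ds^2$; it is finite if this integral is finite. Ramification: let $f\colon\Sigma\to\overline{\mathbf{C}}$ be a meromorphic function on a Riemann surface. A value that $f$ never attains on $\Sigma$ is an omitted value. For $\nu\in\mathbf{Z}\cup\{\infty\}$,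 $\nu\ge2$, a value $\alpha\in\overline{\mathbf{C}}$ is a totally ramified value of $f$ of order $\nu$ if the equation $f=\alpha$ has no root of multiplicity less than $\nu$ on $\Sigma$; omitted values are regarded as totally ramified of order $\infty$, and for an attained totally ramified value the order is the minimum of the multiplicities of the roots. The weight of a totally ramified value of order $\nu$ is $1-\frac1\nu$, and the total weight $\nu_f$ is the sum of the weights of all totally ramified values of $f$. *)

theory Defs
  imports "HOL-Complex_Analysis.Complex_Analysis"
begin

text \<open>
  Riemann surfaces are connected open sets \<open>S\<close> in the complex plane here; the coordinate \<open>z\<close> is
  global, so a differential \<open>f dz\<close> is represented by its coefficient \<open>f\<close>.  A surface in \<open>\<real>\<^sup>3\<close> is a
  map \<open>X :: complex \<Rightarrow> real ^ 3\<close>, of which only the values on \<open>S\<close> matter.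
\<close>

subsection \<open>Surfaces in Euclidean 3-space\<close>

definition dir_deriv :: "complex \<Rightarrow> (complex \<Rightarrow> real ^ 3) \<Rightarrow> complex \<Rightarrow> real ^ 3" where
  "dir_deriv v X z = frechet_derivative X (at z) v"

text \<open>For open \<open>S\<close> this is \<open>C\<^sup>\<infinity>\<close>: all iterated directional derivatives exist and are
  differentiable, hence continuous.\<close>

definition smooth_surface_on :: "complex set \<Rightarrow> (complex \<Rightarrow> real ^ 3) \<Rightarrow> bool" where
  "smooth_surface_on S X \<longleftrightarrow> (\<forall>vs. foldr dir_deriv vs X differentiable_on S)"

definition unit_normal :: "(complex \<Rightarrow> real ^ 3) \<Rightarrow> complex \<Rightarrow> real ^ 3" where
  "unit_normal X z = sgn (cross3 (dir_deriv 1 X z) (dir_deriv \<i> X z))"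

definition fff_E :: "(complex \<Rightarrow> real ^ 3) \<Rightarrow> complex \<Rightarrow> real" where
  "fff_E X z = dir_deriv 1 X z \<bullet> dir_deriv 1 X z"

definition fff_F :: "(complex \<Rightarrow> real ^ 3) \<Rightarrow> complex \<Rightarrow> real" where
  "fff_F X z = dir_deriv 1 X z \<bullet> dir_deriv \<i> X z"

definition fff_G :: "(complex \<Rightarrow> real ^ 3) \<Rightarrow> complex \<Rightarrow> real" where
  "fff_G X z = dir_deriv \<i> X z \<bullet> dir_deriv \<i> X z"

definition sff_L :: "(complex \<Rightarrow> real ^ 3) \<Rightarrow> complex \<Rightarrow> real" where
  "sff_L X z = unit_normal X z \<bullet> dir_deriv 1 (dir_deriv 1 X) z"

definition sff_M :: "(complex \<Rightarrow> real ^ 3) \<Rightarrow> complex \<Rightarrow> real" where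
  "sff_M X z = unit_normal X z \<bullet> dir_deriv \<i> (dir_deriv 1 X) z"

definition sff_N :: "(complex \<Rightarrow> real ^ 3) \<Rightarrow> complex \<Rightarrow> real" where
  "sff_N X z = unit_normal X z \<bullet> dir_deriv \<i> (dir_deriv \<i> X) z"

definition mean_curvature :: "(complex \<Rightarrow> real ^ 3) \<Rightarrow> complex \<Rightarrow> real" where
  "mean_curvature X z =
     (sff_L X z * fff_G X z - 2 * sff_M X z * fff_F X z + sff_N X z * fff_E X z)
       / (2 * (fff_E X z * fff_G X z - (fff_F X z)\<^sup>2))"

definition gauss_curvature :: "(complex \<Rightarrow> real ^ 3) \<Rightarrow> complex \<Rightarrow> real" where
  "gauss_curvature X z =
     (sff_L X z * sff_N X z - (sff_M X z)\<^sup>2) / (fff_E X z * fff_G X z - (fff_F X z)\<^sup>2)"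

text \<open>The coefficient of \<open>du dv\<close> in the area element.\<close>

definition area_density :: "(complex \<Rightarrow> real ^ 3) \<Rightarrow> complex \<Rightarrow> real" where
  "area_density X z = sqrt (fff_E X z * fff_G X z - (fff_F X z)\<^sup>2)"

definition minimal_surface :: "complex set \<Rightarrow> (complex \<Rightarrow> real ^ 3) \<Rightarrow> bool" where
  "minimal_surface S X \<longleftrightarrow>
     open S \<and> connected S \<and> smooth_surface_on S X \<and>
     (\<forall>z\<in>S. inj (frechet_derivative X (at z))) \<and>
     (\<forall>z\<in>S. mean_curvature X z = 0)"

definition finite_total_curvature :: "complex set \<Rightarrow> (complex \<Rightarrow> real ^ 3) \<Rightarrow> bool" where
  "finite_total_curvature S X \<longleftrightarrow>
     set_integrable lborel S (\<lambda>z. gauss_curvature X z * area_density X z)"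

text \<open>A divergent path is parametrised by the half-open interval and eventually leaves every compact
  subset of \<open>S\<close>; break points of the piecewise smooth path may accumulate only at the parameter 1.\<close>

definition divergent_path :: "complex set \<Rightarrow> (real \<Rightarrow> complex) \<Rightarrow> bool" where
  "divergent_path S \<gamma> \<longleftrightarrow>
     \<gamma> ` {0..<1} \<subseteq> S \<and>
     (\<forall>t. 0 \<le> t \<and> t < 1 \<longrightarrow> \<gamma> piecewise_C1_differentiable_on {0..t}) \<and>
     (\<forall>K. compact K \<and> K \<subseteq> S \<longrightarrow> (\<forall>\<^sub>F t in at_left 1. \<gamma> t \<notin> K))"

text \<open>Length with respect to the metric induced by \<open>X\<close>: the norm of the image of the velocity
  vector under the differential of \<open>X\<close> is integrated.  The finitely or countably many break points
  do not contribute.\<close>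

definition induced_length :: "(complex \<Rightarrow> real ^ 3) \<Rightarrow> (real \<Rightarrow> complex) \<Rightarrow> ennreal" where
  "induced_length X \<gamma> =
     (\<integral>\<^sup>+t\<in>{0..<1}. ennreal (norm (dir_deriv (vector_derivative \<gamma> (at t)) X (\<gamma> t))) \<partial>lborel)"

definition complete_surface :: "complex set \<Rightarrow> (complex \<Rightarrow> real ^ 3) \<Rightarrow> bool" where
  "complete_surface S X \<longleftrightarrow> (\<forall>\<gamma>. divergent_path S \<gamma> \<longrightarrow> induced_length X \<gamma> = \<infinity>)"


subsection \<open>Meromorphic functions as maps to the Riemann sphere\<close>

datatype riemann_sphere = Fin complex | Infty

text \<open>Intended for \<open>f\<close> that is nicely meromorphic, so that \<open>f z\<close> is the correct value off the poles.\<close>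

definition sphere_value :: "(complex \<Rightarrow> complex) \<Rightarrow> complex \<Rightarrow> riemann_sphere" where
  "sphere_value f z = (if is_pole f z then Infty else Fin (f z))"

text \<open>Multiplicity of a root \<open>z\<close> of \<open>f = \<alpha>\<close>, for nonconstant \<open>f\<close>.\<close>

fun root_multiplicity :: "(complex \<Rightarrow> complex) \<Rightarrow> riemann_sphere \<Rightarrow> complex \<Rightarrow> nat" where
  "root_multiplicity f (Fin c) z = nat (zorder (\<lambda>w. f w - c) z)"
| "root_multiplicity f Infty z = nat (- zorder f z)"

definition roots_on :: "complex set \<Rightarrow> (complex \<Rightarrow> complex) \<Rightarrow> riemann_sphere \<Rightarrow> complex set" where
  "roots_on S f \<alpha> = {z \<in> S. sphere_value f z = \<alpha>}"

definition totally_ramified_values ::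
    "complex set \<Rightarrow> (complex \<Rightarrow> complex) \<Rightarrow> riemann_sphere set" where
  "totally_ramified_values S f = {\<alpha>. \<forall>z\<in>roots_on S f \<alpha>. 2 \<le> root_multiplicity f \<alpha> z}"

text \<open>The infimum over the empty set is \<open>\<infinity>\<close>, the order of an omitted value; otherwise the infimum is
  the minimum of the multiplicities.\<close>

definition ramification_order ::
    "complex set \<Rightarrow> (complex \<Rightarrow> complex) \<Rightarrow> riemann_sphere \<Rightarrow> enat" where
  "ramification_order S f \<alpha> = (INF z\<in>roots_on S f \<alpha>. enat (root_multiplicity f \<alpha> z))"

fun ramification_weight :: "enat \<Rightarrow> real" where
  "ramification_weight (enat n) = 1 - 1 / real n"
| "ramification_weight \<infinity> = 1"

text \<open>Only meaningful when there are finitely many totally ramified values (all weights are at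
  least \<open>1/2\<close>, so otherwise the total weight is infinite, whereas this sum is 0).\<close>

definition total_weight :: "complex set \<Rightarrow> (complex \<Rightarrow> complex) \<Rightarrow> real" where
  "total_weight S f =
     (\<Sum>\<alpha>\<in>totally_ramified_values S f. ramification_weight (ramification_order S f \<alpha>))"


subsection \<open>Weierstrass data\<close>

text \<open>The coefficient of \<open>\<phi>\<^sub>i\<close>.  At poles of \<open>g\<close> the formula has to be extended by continuity.
  If it has a pole instead of a removable singularity, \<^const>\<open>remove_sings\<close> is not continuous
  there, so that holomorphicity below fails as it should.\<close>

definition weierstrass_form ::
    "(complex \<Rightarrow> complex) \<Rightarrow> (complex \<Rightarrow> complex) \<Rightarrow> 3 \<Rightarrow> complex \<Rightarrow> complex" where
  "weierstrass_form g h i =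
     remove_sings (\<lambda>z. (vector [ 1 / 2 * (1 - (g z)\<^sup>2) * h z,
                                \<i> / 2 * (1 + (g z)\<^sup>2) * h z,
                                g z * h z ] :: complex ^ 3) $ i)"

text \<open>Periods: the closed paths in \<open>S\<close> generate the first homology group.\<close>

definition weierstrass_data ::
    "complex set \<Rightarrow> (complex \<Rightarrow> complex) \<Rightarrow> (complex \<Rightarrow> complex) \<Rightarrow> (complex \<Rightarrow> real ^ 3) \<Rightarrow> bool" where
  "weierstrass_data S g h X \<longleftrightarrow>
     g nicely_meromorphic_on S \<and>
     h holomorphic_on S \<and>
     (\<forall>i. weierstrass_form g h i holomorphic_on S) \<and>
     (\<forall>z\<in>S. \<exists>i. weierstrass_form g h i z \<noteq> 0) \<and>
     (\<forall>c i. valid_path c \<and> pathfinish c = pathstart c \<and> path_image c \<subseteq> S \<longrightarrow>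
        Re (contour_integral c (weierstrass_form g h i)) = 0) \<and>
     (\<exists>z0\<in>S. \<exists>p. \<forall>\<gamma>. valid_path \<gamma> \<and> path_image \<gamma> \<subseteq> S \<and> pathstart \<gamma> = z0 \<longrightarrow>
        X (pathfinish \<gamma>) =
          p + (\<chi> i. Re (contour_integral \<gamma> (\<lambda>z. 2 * weierstrass_form g h i z))))"

text \<open>Stereographic projection from the north pole.\<close>

definition stereographic :: "real ^ 3 \<Rightarrow> riemann_sphere" where
  "stereographic n =
     (if n $ 3 = 1 then Infty else Fin (Complex (n $ 1 / (1 - n $ 3)) (n $ 2 / (1 - n $ 3))))"

definition gauss_map :: "(complex \<Rightarrow> real ^ 3) \<Rightarrow> complex \<Rightarrow> riemann_sphere" where
  "gauss_map X z = stereographic (unit_normal X z)"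

end

theory Submission
  imports Defs "HOL-Probability.Sinc_Integral"
begin

text \<open>
  Put \<open>U = z\<^sup>4\<close> and \<open>V = z\<^sup>2 + 1\<close>, \<open>m = b - a\<close>, \<open>n = 4(b - 1)\<close>.  Numerator and denominator of the Gauss
  map are \<open>q = \<sigma>(m U + n a V)\<close> and \<open>p = m U + n V\<close>, and with \<open>s = 1/(z\<^sup>2 (z\<^sup>2 + 1)\<^sup>2)\<close> the Weierstrass forms
  are \<open>2\<phi> = s (p\<^sup>2 - q\<^sup>2, \<i>(p\<^sup>2 + q\<^sup>2), 2 p q)\<close>.  In this spinor form the poles of \<open>g = q/p\<close> are no longer
  special: the vector on the right is a null vector of \<open>\<complex>\<^sup>3\<close> that is nonzero as soon as \<open>p\<close> and \<open>q\<close> have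
  no common zero.  Every surface whose differential is \<open>v \<mapsto> Re (2\<phi> v)\<close> with such forms is therefore a
  conformal minimal immersion with metric factor \<open>|s| (|p|\<^sup>2 + |q|\<^sup>2)\<close>, Gauss map \<open>q/p\<close> and curvature form
  \<open>K dA = -4 |p' q - p q'|\<^sup>2 / (|p|\<^sup>2 + |q|\<^sup>2)\<^sup>2\<close> (locale \<open>spinor_surface\<close>).

  Existence of the surface.  The coefficients of \<open>2\<phi>\<close> are combinations of \<open>s U\<^sup>2\<close>, \<open>s U V\<close> and \<open>s V\<^sup>2\<close>,
  which have rational primitives up to multiples of \<open>\<integral> dz/(z\<^sup>2 + 1)\<close>.  The value of \<open>\<sigma>\<^sup>2\<close> and its negative
  sign say exactly that these multiples are purely imaginary, so that the real part of the integral is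
  the single-valued function \<open>ln |z - \<i>| - ln |z + \<i>|\<close> up to a real factor
  (\<open>has_derivative_primitive_part\<close>, \<open>residue_condition\<close>).  The surface is thus given by a closed formula,
  and vanishing of the periods follows from it by the fundamental theorem of calculus.

  Completeness and finite total curvature.  Both \<open>U\<close> and \<open>V\<close> are linear combinations of \<open>p\<close> and \<open>q\<close>, hence
  \<open>(1 + |z|\<^sup>2)\<^sup>4 \<le> C (|p|\<^sup>2 + |q|\<^sup>2)\<close> (\<open>quartic_pair_growth\<close>).  It follows that the derivatives of the
  functions \<open>z\<close>, \<open>1/z\<close>, \<open>1/(z - \<i>)\<close>, \<open>1/(z + \<i>)\<close> are bounded by a multiple of the metric factor.  On a path
  of finite length these functions stay bounded, so the path stays in a compact set and cannot be
  divergent.  The same estimate bounds the curvature density by a multiple of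
  \<open>1/(1 + |z|\<^sup>2)\<^sup>2\<close>, which is integrable over the plane.

  Ramification.  The equation \<open>g = c\<close> is a quartic equation \<open>\<mu> z\<^sup>4 + \<nu> (z\<^sup>2 + 1) = 0\<close> with \<open>\<mu> = m(\<sigma> - c)\<close> and
  \<open>\<nu> = n(\<sigma> a - c)\<close>.  It has only the roots \<open>\<plusminus>\<i>\<close> if \<open>\<mu> = 0\<close> and only the root \<open>0\<close> if \<open>\<nu> = 0\<close>, which makes \<open>\<sigma>\<close>
  and \<open>\<sigma> a\<close> omitted values.  It is \<open>\<mu> (z\<^sup>2 + 2)\<^sup>2 = 0\<close> if \<open>\<nu> = 4 \<mu>\<close>, which is the case \<open>c = \<sigma> b\<close>.  In all
  other cases, and for the poles, the roots are simple and lie in the domain.  The total weight is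
  \<open>1 + 1 + 1/2\<close>.
\<close>

(* Formal power series share the infix notation for components with vectors. *)
unbundle no fps_syntax

section \<open>Real parts of holomorphic vectors\<close>

text \<open>
  The differential of each surface below is of the form \<open>v \<mapsto> re_vec (\<lambda>i. v * F i z)\<close> with
  holomorphic \<open>F i\<close>.
\<close>

definition re_vec :: "(3 \<Rightarrow> complex) \<Rightarrow> real ^ 3" where
  "re_vec w = (\<chi> i. Re (w i))"

lemma re_vec_nth [simp]: "re_vec w $ i = Re (w i)"
  by (simp add: re_vec_def)

lemma has_derivative_vec3:
  fixes X :: "complex \<Rightarrow> real ^ 3"
  assumes "\<And>i. ((\<lambda>w. X w $ i) has_derivative (\<lambda>v. D v $ i)) (at z)"
  shows "(X has_derivative D) (at z)"
  unfolding has_derivative_componentwise_within[of X D z UNIV]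
proof
  fix u :: "real ^ 3" assume "u \<in> Basis"
  then obtain i where "u = axis i 1" by (auto simp: Basis_vec_def)
  then show "((\<lambda>x. X x \<bullet> u) has_derivative (\<lambda>x. D x \<bullet> u)) (at z)"
    using assms[of i] by (simp add: inner_axis)
qed

lemma has_derivative_re_vec:
  assumes "\<And>i. (F i has_field_derivative F' i) (at z)"
  shows "((\<lambda>w. re_vec (\<lambda>i. F i w)) has_derivative (\<lambda>v. re_vec (\<lambda>i. v * F' i))) (at z)"
proof (rule has_derivative_vec3)
  fix i
  have "((\<lambda>w. F i w) has_derivative (\<lambda>v. v * F' i)) (at z)"
    using assms[of i] by (simp add: has_field_derivative_def mult.commute[of _ "F' i"])
  then show "((\<lambda>w. re_vec (\<lambda>i. F i w) $ i) has_derivative (\<lambda>v. re_vec (\<lambda>i. v * F' i) $ i)) (at z)"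
    unfolding re_vec_nth by (rule has_derivative_Re)
qed

lemma dir_deriv_eqI:
  assumes "(X has_derivative D) (at z)"
  shows "dir_deriv v X z = D v"
  using frechet_derivative_at[OF assms] by (simp add: dir_deriv_def)

lemma dir_deriv_re_vec:
  assumes "open S" "z \<in> S" "\<And>w. w \<in> S \<Longrightarrow> Y w = re_vec (\<lambda>i. F i w)" "\<And>i. F i holomorphic_on S"
  shows "(Y has_derivative (\<lambda>v. re_vec (\<lambda>i. v * deriv (F i) z))) (at z)"
    and "dir_deriv v Y z = re_vec (\<lambda>i. v * deriv (F i) z)"
proof -
  have "(F i has_field_derivative deriv (F i) z) (at z)" for i
    using assms(4,1,2) by (rule holomorphic_derivI)
  from has_derivative_re_vec[OF this]
  show D: "(Y has_derivative (\<lambda>v. re_vec (\<lambda>i. v * deriv (F i) z))) (at z)"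
    by (rule has_derivative_transform_within_open[OF _ assms(1,2)]) (simp only: assms(3))
  show "dir_deriv v Y z = re_vec (\<lambda>i. v * deriv (F i) z)"
    by (rule dir_deriv_eqI[OF D])
qed

text \<open>
  A directional derivative of the real part of a holomorphic vector is again such a real part, so the
  class is closed under iteration.  The surface itself need not belong to it, since it may be the real
  part of a multivalued function; hence the list must be nonempty.
\<close>

lemma foldr_dir_deriv_re_vec:
  assumes "open S" "\<And>i. F i holomorphic_on S"
    and X: "\<And>z. z \<in> S \<Longrightarrow> (X has_derivative (\<lambda>v. re_vec (\<lambda>i. v * F i z))) (at z)"
  shows "\<exists>G. (\<forall>i. G i holomorphic_on S) \<and>
             (\<forall>z\<in>S. foldr dir_deriv (v # vs) X z = re_vec (\<lambda>i. G i z))"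
proof (induction vs arbitrary: v)
  case Nil
  show ?case
    using assms(2) dir_deriv_eqI[OF X]
    by (intro exI[of _ "\<lambda>i z. v * F i z"]) (auto intro!: holomorphic_intros)
next
  case (Cons u vs)
  then obtain G where G: "\<And>i. G i holomorphic_on S"
    "\<And>z. z \<in> S \<Longrightarrow> foldr dir_deriv (u # vs) X z = re_vec (\<lambda>i. G i z)" by blast
  have "foldr dir_deriv (v # u # vs) X z = re_vec (\<lambda>i. v * deriv (G i) z)" if "z \<in> S" for z
    unfolding foldr.simps(2)[of _ v] o_apply
    by (rule dir_deriv_re_vec(2)[OF \<open>open S\<close> that G(2) G(1)])
  moreover have "(\<lambda>z. v * deriv (G i) z) holomorphic_on S" for i
    using G(1)[of i] \<open>open S\<close> by (intro holomorphic_intros)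
  ultimately show ?case
    by (intro exI[of _ "\<lambda>i z. v * deriv (G i) z"]) blast
qed

lemma smooth_surface_on_re_primitive:
  assumes "open S" "\<And>i. F i holomorphic_on S"
    and X: "\<And>z. z \<in> S \<Longrightarrow> (X has_derivative (\<lambda>v. re_vec (\<lambda>i. v * F i z))) (at z)"
  shows "smooth_surface_on S X"
  unfolding smooth_surface_on_def differentiable_on_def
proof safe
  fix vs :: "complex list" and z assume z: "z \<in> S"
  have "foldr dir_deriv vs X differentiable at z"
  proof (cases vs)
    case Nil
    then show ?thesis using X[OF z] unfolding differentiable_def by auto
  next
    case (Cons v us)
    then obtain G where G: "\<And>i. G i holomorphic_on S"
      "\<And>z. z \<in> S \<Longrightarrow> foldr dir_deriv vs X z = re_vec (\<lambda>i. G i z)"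
      using foldr_dir_deriv_re_vec[OF assms, of v us] unfolding Cons by blast
    show ?thesis
      using dir_deriv_re_vec(1)[OF \<open>open S\<close> z G(2) G(1)] unfolding differentiable_def by blast
  qed
  then show "foldr dir_deriv vs X differentiable at z within S"
    by (rule differentiable_at_withinI)
qed

text \<open>
  A single-valued real primitive gives both the vanishing of the real periods and the integral
  representation of the surface, without any choice of generators of the homology.
\<close>

lemma Re_contour_integral_re_primitive:
  fixes Y :: "complex \<Rightarrow> real"
  assumes "open S" "f holomorphic_on S" "valid_path \<gamma>" "path_image \<gamma> \<subseteq> S"
    and Y: "\<And>z. z \<in> S \<Longrightarrow> (Y has_derivative (\<lambda>v. Re (v * f z))) (at z)"
  shows "Re (contour_integral \<gamma> f) = Y (pathfinish \<gamma>) - Y (pathstart \<gamma>)"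
proof -
  have "f contour_integrable_on \<gamma>"
    using assms by (intro contour_integrable_holomorphic_simple)
  then have "((\<lambda>t. f (\<gamma> t) * vector_derivative \<gamma> (at t within {0..1}))
               has_integral contour_integral \<gamma> f) {0..1}"
    using has_contour_integral_integral has_contour_integral_def by blast
  from has_integral_linear[OF this bounded_linear_Re]
  have 1: "((\<lambda>t. Re (f (\<gamma> t) * vector_derivative \<gamma> (at t within {0..1})))
               has_integral Re (contour_integral \<gamma> f)) {0..1}"
    by (simp add: o_def)
  obtain T where T: "finite T" "\<gamma> C1_differentiable_on {0..1} - T" and cont: "continuous_on {0..1} \<gamma>"
    using \<open>valid_path \<gamma>\<close> by (auto simp: valid_path_def piecewise_C1_differentiable_on_def)
  have S: "\<gamma> t \<in> S" if "t \<in> {0..1}" for t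
    using assms(4) that by (auto simp: path_image_def)
  have "((\<lambda>t. Re (f (\<gamma> t) * vector_derivative \<gamma> (at t within {0..1})))
           has_integral (Y (\<gamma> 1) - Y (\<gamma> 0))) {0..1}"
  proof (rule fundamental_theorem_of_calculus_interior_strong[OF \<open>finite T\<close>])
    have "continuous_on S Y"
      using Y has_derivative_continuous continuous_at_imp_continuous_on by blast
    then show "continuous_on {0..1} (\<lambda>t. Y (\<gamma> t))"
      using cont S by (auto intro!: continuous_on_compose2[of S Y])
    fix t assume t: "t \<in> {0<..<1} - T"
    then have "\<gamma> differentiable at t"
      using T(2) by (auto simp: C1_differentiable_on_eq)
    then have "(\<gamma> has_vector_derivative vector_derivative \<gamma> (at t)) (at t)"
      by (simp add: vector_derivative_works)
    moreover have "vector_derivative \<gamma> (at t within {0..1}) = vector_derivative \<gamma> (at t)"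
      using t by (intro vector_derivative_at_within_ivl)
        (auto simp: \<open>\<gamma> differentiable at t\<close> vector_derivative_works[symmetric])
    ultimately have "(\<gamma> has_derivative (\<lambda>h. h *\<^sub>R vector_derivative \<gamma> (at t within {0..1}))) (at t)"
      by (simp add: has_vector_derivative_def)
    from has_derivative_compose[OF this Y[OF S]] t
    show "((\<lambda>t. Y (\<gamma> t)) has_vector_derivative
             Re (f (\<gamma> t) * vector_derivative \<gamma> (at t within {0..1}))) (at t)"
      by (simp add: has_vector_derivative_def mult_ac)
  qed auto
  from has_integral_unique[OF 1 this] show ?thesis
    by (simp add: pathfinish_def pathstart_def)
qed

text \<open>
  Locally \<open>ln |w - c|\<close> is the real part of a branch of the logarithm of \<open>w - c\<close>.
\<close>

lemma has_derivative_ln_norm_diff: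
  fixes z c :: complex
  assumes "z \<noteq> c"
  shows "((\<lambda>w. ln (norm (w - c))) has_derivative (\<lambda>v. Re (v / (z - c)))) (at z)"
proof -
  have eq: "v \<bullet> sgn (z - c) / norm (z - c) = Re (v / (z - c))" for v
  proof -
    have "Re (v / (z - c)) = Re (v * cnj (z - c)) / (norm (z - c))\<^sup>2"
      by (subst complex_div_cnj) simp
    also have "Re (v * cnj (z - c)) = v \<bullet> (z - c)" by (simp add: inner_complex_def algebra_simps)
    finally show ?thesis
      by (simp add: sgn_div_norm power2_eq_square divide_inverse del: complex_cnj_diff)
  qed
  have "((\<lambda>w. norm (w - c)) has_derivative (\<lambda>v. v \<bullet> sgn (z - c))) (at z)"
    by (rule has_derivative_compose[where g = norm, OF _ has_derivative_norm])
       (use assms in \<open>auto intro!: derivative_eq_intros\<close>)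
  then have "((\<lambda>w. ln (norm (w - c))) has_derivative (\<lambda>v. v \<bullet> sgn (z - c) / norm (z - c))) (at z)"
    by (intro derivative_eq_intros) (use assms in \<open>auto simp: divide_inverse\<close>)
  then show ?thesis by (simp only: eq)
qed

section \<open>Null vectors in complex 3-space\<close>

text \<open>
  The quadratic parametrisation of the isotropic cone \<open>w\<^sub>1\<^sup>2 + w\<^sub>2\<^sup>2 + w\<^sub>3\<^sup>2 = 0\<close> in \<open>\<complex>\<^sup>3\<close>.
\<close>

definition null_vector :: "complex \<Rightarrow> complex \<Rightarrow> 3 \<Rightarrow> complex" where
  "null_vector P Q i = (vector [P\<^sup>2 - Q\<^sup>2, \<i> * (P\<^sup>2 + Q\<^sup>2), 2 * P * Q] :: complex ^ 3) $ i"

text \<open>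
  The real vector of length \<open>spinor_norm P Q\<close> in the direction that stereographic projection maps to
  \<open>Q / P\<close>; it has no denominators, and makes sense for \<open>P = 0\<close> too.
\<close>

definition spinor_normal :: "complex \<Rightarrow> complex \<Rightarrow> real ^ 3" where
  "spinor_normal P Q =
     vector [2 * Re (Q * cnj P), 2 * Im (Q * cnj P), (cmod Q)\<^sup>2 - (cmod P)\<^sup>2]"

definition spinor_norm :: "complex \<Rightarrow> complex \<Rightarrow> real" where
  "spinor_norm P Q = (cmod P)\<^sup>2 + (cmod Q)\<^sup>2"

lemma null_vector_simps [simp]:
  "null_vector P Q 1 = P\<^sup>2 - Q\<^sup>2"
  "null_vector P Q 2 = \<i> * (P\<^sup>2 + Q\<^sup>2)"
  "null_vector P Q 3 = 2 * P * Q"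
  by (simp_all add: null_vector_def)

lemma spinor_norm_pos: "P \<noteq> 0 \<or> Q \<noteq> 0 \<Longrightarrow> spinor_norm P Q > 0"
  by (auto simp: spinor_norm_def add_pos_nonneg add_nonneg_pos)

lemma sum_null_vector_square: "(\<Sum>i\<in>UNIV. (null_vector P Q i)\<^sup>2) = 0"
  by (simp add: sum_3 power2_eq_square algebra_simps)

text \<open>
  The parallelogram law for \<open>P\<^sup>2\<close> and \<open>Q\<^sup>2\<close>.
\<close>

lemma sum_norm_null_vector: "(\<Sum>i\<in>UNIV. (cmod (null_vector P Q i))\<^sup>2) = 2 * (spinor_norm P Q)\<^sup>2"
proof -
  have "(cmod (P\<^sup>2 - Q\<^sup>2))\<^sup>2 + (cmod (P\<^sup>2 + Q\<^sup>2))\<^sup>2 = 2 * (cmod (P\<^sup>2))\<^sup>2 + 2 * (cmod (Q\<^sup>2))\<^sup>2"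
    unfolding cmod_power2 by (simp add: power2_eq_square algebra_simps)
  then show ?thesis
    by (simp add: sum_3 norm_mult norm_power spinor_norm_def power_mult_distrib power2_sum)

qed

text \<open>
  From \<open>2 Re \<alpha> Re \<beta> = Re (\<alpha> \<beta>) + Re (\<alpha> cnj \<beta>)\<close>: the first terms add up to \<open>u v \<Sum> w\<^sub>i\<^sup>2 = 0\<close>.  This is
  conformality of \<open>v \<mapsto> re_vec (v w)\<close> for isotropic \<open>w\<close>.
\<close>

lemma inner_re_vec:
  assumes "(\<Sum>i\<in>UNIV. (w i)\<^sup>2) = 0"
  shows "re_vec (\<lambda>i. u * w i) \<bullet> re_vec (\<lambda>i. v * w i) = Re (u * cnj v) * (\<Sum>i\<in>UNIV. (cmod (w i))\<^sup>2) / 2"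
proof -
  have "Re (u * w i) * Re (v * w i) =
          (Re (u * v * (w i)\<^sup>2) + Re (u * cnj v) * (cmod (w i))\<^sup>2) / 2" for i
    unfolding cmod_power2 by (simp add: power2_eq_square algebra_simps)
  then have "re_vec (\<lambda>i. u * w i) \<bullet> re_vec (\<lambda>i. v * w i) =
      (\<Sum>i\<in>UNIV. (Re (u * v * (w i)\<^sup>2) + Re (u * cnj v) * (cmod (w i))\<^sup>2) / 2)"
    by (simp only: inner_vec_def re_vec_nth inner_real_def)
  also have "\<dots> = (Re (u * v * (\<Sum>i\<in>UNIV. (w i)\<^sup>2)) +
      Re (u * cnj v) * (\<Sum>i\<in>UNIV. (cmod (w i))\<^sup>2)) / 2"
    by (simp only: sum_divide_distrib[symmetric] sum.distrib sum_distrib_left Re_sum)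
  finally show ?thesis by (simp add: assms)
qed

lemma inner_null_vector:
  "re_vec (\<lambda>i. u * (t * null_vector P Q i)) \<bullet> re_vec (\<lambda>i. v * (t * null_vector P Q i)) =
     Re (u * cnj v) * (cmod t * spinor_norm P Q)\<^sup>2"
proof -
  have "(\<Sum>i\<in>UNIV. (t * null_vector P Q i)\<^sup>2) = 0"
    by (simp add: power_mult_distrib sum_null_vector_square flip: sum_distrib_left)
  from inner_re_vec[of "\<lambda>i. t * null_vector P Q i", OF this, of u v] show ?thesis
    by (simp add: norm_mult power_mult_distrib sum_norm_null_vector flip: sum_distrib_left)
qed

lemma inner_re_vec_right:
  "n \<bullet> re_vec (\<lambda>i. v * w i) = Re (v * (\<Sum>i\<in>UNIV. of_real (n $ i) * w i))"
  by (simp add: inner_vec_def sum_3 algebra_simps)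

text \<open>
  In terms of \<open>P\<close>, \<open>Q\<close> and their conjugates, identities for the normal become polynomial ones.
\<close>

lemma spinor_normal_nth:
  "complex_of_real (spinor_normal P Q $ 1) = Q * cnj P + cnj Q * P"
  "complex_of_real (spinor_normal P Q $ 2) = - \<i> * (Q * cnj P - cnj Q * P)"
  "complex_of_real (spinor_normal P Q $ 3) = Q * cnj Q - P * cnj P"
  unfolding spinor_normal_def cmod_power2
  by (simp_all add: complex_eq_iff power2_eq_square algebra_simps)

lemma spinor_norm_complex: "complex_of_real (spinor_norm P Q) = P * cnj P + Q * cnj Q"
  unfolding spinor_norm_def cmod_power2 by (simp add: complex_eq_iff power2_eq_square algebra_simps)

lemma norm_spinor_normal: "norm (spinor_normal P Q) = spinor_norm P Q"
proof -
  have "complex_of_real (spinor_normal P Q \<bullet> spinor_normal P Q) =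
      complex_of_real ((spinor_norm P Q)\<^sup>2)"
    by (simp add: inner_vec_def sum_3 spinor_normal_nth spinor_norm_complex power2_eq_square algebra_simps)
  then have "spinor_normal P Q \<bullet> spinor_normal P Q = (spinor_norm P Q)\<^sup>2"
    by (simp only: of_real_eq_iff)
  then show ?thesis
    by (simp add: norm_eq_sqrt_inner spinor_norm_def)
qed

text \<open>
  The components of the cross product of \<open>Re w\<close> and \<open>Re (\<i> w)\<close> are \<open>Im (w\<^sub>2 cnj w\<^sub>3)\<close> and its cyclic
  variants.  The factor \<open>1\<close> on the left matches the derivative in the direction \<open>1\<close>.
\<close>

lemma cross3_null_vector:
  "cross3 (re_vec (\<lambda>i. 1 * (t * null_vector P Q i))) (re_vec (\<lambda>i. \<i> * (t * null_vector P Q i))) =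
     ((cmod t)\<^sup>2 * spinor_norm P Q) *\<^sub>R spinor_normal P Q"
proof -
  have *: "Re x * Re (\<i> * y) - Re y * Re (\<i> * x) = Im (x * cnj y)" for x y
    by simp
  have "cross3 (re_vec (\<lambda>i. 1 * (t * null_vector P Q i))) (re_vec (\<lambda>i. \<i> * (t * null_vector P Q i))) =
    vector [Im (t * null_vector P Q 2 * cnj (t * null_vector P Q 3)),
            Im (t * null_vector P Q 3 * cnj (t * null_vector P Q 1)),
            Im (t * null_vector P Q 1 * cnj (t * null_vector P Q 2))]"
    by (simp only: cross3_def re_vec_nth * mult_1)
  also have "\<dots> = (cmod t)\<^sup>2 *\<^sub>R vector [Im (null_vector P Q 2 * cnj (null_vector P Q 3)),
            Im (null_vector P Q 3 * cnj (null_vector P Q 1)),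
            Im (null_vector P Q 1 * cnj (null_vector P Q 2))]"
  proof -
    have "t * x * cnj (t * y) = of_real ((cmod t)\<^sup>2) * (x * cnj y)" for x y
      by (simp add: complex_norm_square mult_ac del: of_real_power)
    then have "Im (t * x * cnj (t * y)) = (cmod t)\<^sup>2 * Im (x * cnj y)" for x y
      by (metis Im_complex_of_real Re_complex_of_real add.right_neutral mult_zero_left times_complex.sel(2))
    then show ?thesis
      by (simp only: vec_eq_iff forall_3 vector_3 vector_scaleR_component real_scaleR_def simp_thms)
  qed
  also have "vector [Im (null_vector P Q 2 * cnj (null_vector P Q 3)),
            Im (null_vector P Q 3 * cnj (null_vector P Q 1)),
            Im (null_vector P Q 1 * cnj (null_vector P Q 2))] = spinor_norm P Q *\<^sub>R spinor_normal P Q"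
    unfolding spinor_normal_def spinor_norm_def cmod_power2
    by (simp add: vec_eq_iff forall_3 power2_eq_square algebra_simps)
  finally show ?thesis by simp
qed

lemma sgn_cross3_null_vector:
  assumes "t \<noteq> 0" "P \<noteq> 0 \<or> Q \<noteq> 0"
  shows "sgn (cross3 (re_vec (\<lambda>i. 1 * (t * null_vector P Q i))) (re_vec (\<lambda>i. \<i> * (t * null_vector P Q i)))) =
    spinor_normal P Q /\<^sub>R spinor_norm P Q"
  using assms spinor_norm_pos[of P Q]
  unfolding cross3_null_vector sgn_div_norm norm_scaleR norm_spinor_normal
  by (simp add: field_simps)

lemma spinor_normal_null_vector:
  "(\<Sum>i\<in>UNIV. of_real (spinor_normal P Q $ i) * null_vector P Q i) = 0"
  by (simp add: sum_3 spinor_normal_nth power2_eq_square algebra_simps)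

definition null_vector_deriv :: "complex \<Rightarrow> complex \<Rightarrow> complex \<Rightarrow> complex \<Rightarrow> 3 \<Rightarrow> complex" where
  "null_vector_deriv P Q P' Q' i =
     (vector [2 * P * P' - 2 * Q * Q', \<i> * (2 * P * P' + 2 * Q * Q'), 2 * (P' * Q + P * Q')] :: complex ^ 3) $ i"

text \<open>
  Together with the orthogonality of the normal to the null vector itself, this reduces the second
  fundamental form to the Wronskian of \<open>P\<close> and \<open>Q\<close>.
\<close>

lemma spinor_normal_null_vector_deriv:
  "(\<Sum>i\<in>UNIV. of_real (spinor_normal P Q $ i) * null_vector_deriv P Q P' Q' i) =
     2 * of_real (spinor_norm P Q) * (P' * Q - P * Q')"
  by (simp add: sum_3 spinor_normal_nth spinor_norm_complex null_vector_deriv_def power2_eq_square algebra_simps)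

lemma has_field_derivative_null_vector:
  assumes "(p has_field_derivative p') (at z)" "(q has_field_derivative q') (at z)"
  shows "((\<lambda>z. null_vector (p z) (q z) i) has_field_derivative null_vector_deriv (p z) (q z) p' q' i) (at z)"
proof -
  have "\<forall>i. ((\<lambda>z. null_vector (p z) (q z) i) has_field_derivative null_vector_deriv (p z) (q z) p' q' i) (at z)"
    unfolding forall_3 null_vector_simps
    by (auto intro!: derivative_eq_intros assms simp: null_vector_deriv_def algebra_simps)
  then show ?thesis by blast
qed

section \<open>Quotients as maps to the sphere\<close>

lemma is_pole_quotient:
  fixes p q :: "complex \<Rightarrow> complex"
  assumes "isCont p z" "isCont q z" "p z = 0" "q z \<noteq> 0" "\<forall>\<^sub>F w in at z. p w \<noteq> 0"
  shows "is_pole (\<lambda>z. q z / p z) z"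
  using assms by (intro is_pole_divide) (auto simp: filterlim_at isCont_def)

lemma not_is_pole_quotient:
  fixes p q :: "complex \<Rightarrow> complex"
  assumes "isCont p z" "isCont q z" "p z \<noteq> 0"
  shows "(\<lambda>z. q z / p z) \<midarrow>z\<rightarrow> q z / p z" "\<not> is_pole (\<lambda>z. q z / p z) z"
proof -
  show "(\<lambda>z. q z / p z) \<midarrow>z\<rightarrow> q z / p z"
    using assms by (auto simp: isCont_def intro!: tendsto_intros)
  then show "\<not> is_pole (\<lambda>z. q z / p z) z"
    unfolding is_pole_def using not_tendsto_and_filterlim_at_infinity by (metis at_neq_bot)
qed

lemma sphere_value_quotient:
  fixes p q :: "complex \<Rightarrow> complex"
  assumes "isCont p z" "isCont q z" "p z \<noteq> 0 \<or> q z \<noteq> 0" "\<forall>\<^sub>F w in at z. p w \<noteq> 0"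
  shows "sphere_value (\<lambda>z. q z / p z) z = (if p z = 0 then Infty else Fin (q z / p z))"
  using is_pole_quotient[where p = p and q = q] not_is_pole_quotient(2)[where p = p and q = q] assms by (auto simp: sphere_value_def)

section \<open>Minimal surfaces from spinors\<close>

definition spinor_form ::
    "(complex \<Rightarrow> complex) \<Rightarrow> (complex \<Rightarrow> complex) \<Rightarrow> (complex \<Rightarrow> complex) \<Rightarrow> 3 \<Rightarrow> complex \<Rightarrow> complex" where
  "spinor_form p q s i z = s z * null_vector (p z) (q z) i"

text \<open>
  A surface with the Weierstrass data \<open>g = q / p\<close>, \<open>h = s p\<^sup>2\<close>, written in terms of the spinors \<open>p\<close>, \<open>q\<close>.
  The form \<open>spinor_form p q s\<close> is twice the triple of Weierstrass forms.
\<close>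

locale spinor_surface =
  fixes S :: "complex set" and p q s :: "complex \<Rightarrow> complex" and X :: "complex \<Rightarrow> real ^ 3"
  assumes open_S: "open S" and connected_S: "connected S"
    and holomorphic_p: "p holomorphic_on S"
    and holomorphic_q: "q holomorphic_on S"
    and holomorphic_s: "s holomorphic_on S"
    and s_nonzero: "\<And>z. z \<in> S \<Longrightarrow> s z \<noteq> 0"
    and spinor_nonzero: "\<And>z. z \<in> S \<Longrightarrow> p z \<noteq> 0 \<or> q z \<noteq> 0"
    and X_derivative: "\<And>z. z \<in> S \<Longrightarrow>
      (X has_derivative (\<lambda>v. re_vec (\<lambda>i. v * spinor_form p q s i z))) (at z)"
begin

abbreviation N :: "complex \<Rightarrow> real" where "N z \<equiv> spinor_norm (p z) (q z)"

lemma N_pos: "z \<in> S \<Longrightarrow> N z > 0"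
  by (rule spinor_norm_pos[OF spinor_nonzero])

lemma speed_pos: "z \<in> S \<Longrightarrow> cmod (s z) * N z > 0"
  using N_pos[of z] s_nonzero[of z] by simp

lemma spinor_form_has_derivative:
  assumes "z \<in> S"
  shows "(spinor_form p q s i has_field_derivative
    (deriv s z * null_vector (p z) (q z) i + s z * null_vector_deriv (p z) (q z) (deriv p z) (deriv q z) i)) (at z)"
  unfolding spinor_form_def[abs_def]
  using assms holomorphic_p holomorphic_q holomorphic_s open_S
  by (auto intro!: derivative_eq_intros has_field_derivative_null_vector holomorphic_derivI)

lemma holomorphic_spinor_form: "spinor_form p q s i holomorphic_on S"
  using spinor_form_has_derivative holomorphic_on_open[OF open_S] by blast

lemma dir_deriv_X: "z \<in> S \<Longrightarrow> dir_deriv v X z = re_vec (\<lambda>i. v * (s z * null_vector (p z) (q z) i))"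
  using dir_deriv_eqI[OF X_derivative] by (simp add: spinor_form_def)

lemma dir_deriv_dir_deriv_X:
  assumes "z \<in> S"
  shows "dir_deriv w (dir_deriv v X) z = re_vec (\<lambda>i. w * v * deriv (spinor_form p q s i) z)"
proof -
  have "dir_deriv w (dir_deriv v X) z = re_vec (\<lambda>i. w * deriv (\<lambda>z. v * spinor_form p q s i z) z)"
    by (rule dir_deriv_re_vec(2)[OF open_S assms])
       (use dir_deriv_eqI[OF X_derivative] in \<open>auto intro!: holomorphic_intros holomorphic_spinor_form\<close>)
  moreover have "deriv (\<lambda>z. v * spinor_form p q s i z) z = v * deriv (spinor_form p q s i) z" for i
    by (rule deriv_cmult[OF holomorphic_on_imp_differentiable_at[OF holomorphic_spinor_form open_S assms]])
  ultimately show ?thesis by (simp only: mult.assoc)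
qed

lemma first_fundamental_form:
  assumes "z \<in> S"
  shows "fff_E X z = (cmod (s z) * N z)\<^sup>2" "fff_F X z = 0" "fff_G X z = (cmod (s z) * N z)\<^sup>2"
  unfolding fff_E_def fff_F_def fff_G_def dir_deriv_X[OF assms] inner_null_vector by simp_all

lemma norm_dir_deriv_X:
  assumes "z \<in> S"
  shows "norm (dir_deriv v X z) = cmod v * (cmod (s z) * N z)"
proof -
  have "(norm (dir_deriv v X z))\<^sup>2 = (cmod v)\<^sup>2 * (cmod (s z) * N z)\<^sup>2"
    unfolding power2_norm_eq_inner[of "dir_deriv v X z"]
    unfolding dir_deriv_X[OF assms] inner_null_vector cmod_power2[of v]
    by (simp add: power2_eq_square)
  then have "(norm (dir_deriv v X z))\<^sup>2 = (cmod v * (cmod (s z) * N z))\<^sup>2"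
    by (simp add: power_mult_distrib)
  then show ?thesis
    by (rule power2_eq_imp_eq) (use speed_pos[OF assms] in auto)
qed

lemma unit_normal_X:
  assumes "z \<in> S"
  shows "unit_normal X z = spinor_normal (p z) (q z) /\<^sub>R N z"
  unfolding unit_normal_def dir_deriv_X[OF assms]
  by (rule sgn_cross3_null_vector[OF s_nonzero[OF assms] spinor_nonzero[OF assms]])

text \<open>
  Differentiating the coefficient \<open>s\<close> contributes a multiple of the null vector, which is orthogonal to
  the normal.  The three coefficients are the values at \<open>w v = 1, \<i>, -1\<close>; that those for \<open>1\<close> and \<open>-1\<close>
  cancel is minimality.
\<close>

lemma second_fundamental_form:
  assumes "z \<in> S"
  shows "unit_normal X z \<bullet> dir_deriv w (dir_deriv v X) z =
    Re (w * v * (2 * s z * (deriv p z * q z - p z * deriv q z)))"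
proof -
  have nz: "complex_of_real (N z) \<noteq> 0" using N_pos[OF assms] by simp
  have "(\<Sum>i\<in>UNIV. of_real (unit_normal X z $ i) * deriv (spinor_form p q s i) z) =
     (\<Sum>i\<in>UNIV. of_real (spinor_normal (p z) (q z) $ i) *
       (deriv s z * null_vector (p z) (q z) i +
        s z * null_vector_deriv (p z) (q z) (deriv p z) (deriv q z) i)) / of_real (N z)"
    by (simp add: unit_normal_X[OF assms] DERIV_imp_deriv[OF spinor_form_has_derivative[OF assms]]
          sum_distrib_left sum_divide_distrib divide_inverse mult_ac)
  also have "\<dots> = (deriv s z * (\<Sum>i\<in>UNIV. of_real (spinor_normal (p z) (q z) $ i) * null_vector (p z) (q z) i)
     + s z * (\<Sum>i\<in>UNIV. of_real (spinor_normal (p z) (q z) $ i) *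
                null_vector_deriv (p z) (q z) (deriv p z) (deriv q z) i)) / of_real (N z)"
    by (simp only: sum_distrib_left sum.distrib[symmetric] distrib_left mult_ac)
  also have "\<dots> = 2 * s z * (deriv p z * q z - p z * deriv q z)"
    unfolding spinor_normal_null_vector spinor_normal_null_vector_deriv using nz by simp
  finally show ?thesis
    unfolding dir_deriv_dir_deriv_X[OF assms] inner_re_vec_right by simp
qed

lemma mean_curvature_zero:
  assumes "z \<in> S"
  shows "mean_curvature X z = 0"
proof -
  define H where "H = 2 * s z * (deriv p z * q z - p z * deriv q z)"
  have "Re (\<i> * \<i> * H) = - Re (1 * 1 * H)" by simp
  then show ?thesis
    unfolding mean_curvature_def sff_L_def sff_M_def sff_N_def
      first_fundamental_form[OF assms] second_fundamental_form[OF assms] H_def[symmetric]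
    by simp
qed

text \<open>
  The factor \<open>s\<close> cancels: \<open>K dA\<close> is minus the pullback of the area form of the sphere under \<open>q / p\<close>, so
  it extends smoothly over all points where \<open>p\<close> and \<open>q\<close> are holomorphic without common zero.
\<close>

lemma curvature_form:
  assumes "z \<in> S"
  shows "gauss_curvature X z * area_density X z =
    - (4 * (cmod (deriv p z * q z - p z * deriv q z))\<^sup>2 / (N z)\<^sup>2)"
proof -
  define e W where "e = cmod (s z) * N z" and "W = deriv p z * q z - p z * deriv q z"
  define H where "H = 2 * s z * W"
  \<comment> \<open>\<open>H\<close> is the Hopf differential: the second fundamental form is its real part.\<close>
  have e: "e > 0" using speed_pos[OF assms] by (simp add: e_def)
  have "gauss_curvature X z = (Re H * Re (\<i> * \<i> * H) - (Re (\<i> * H))\<^sup>2) / (e\<^sup>2 * e\<^sup>2)"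
    unfolding gauss_curvature_def sff_L_def sff_M_def sff_N_def
    by (simp only: first_fundamental_form[OF assms] second_fundamental_form[OF assms] mult_1 mult_1_right
        e_def[symmetric] W_def[symmetric] H_def[symmetric]) simp
  also have "Re H * Re (\<i> * \<i> * H) - (Re (\<i> * H))\<^sup>2 = - (cmod H)\<^sup>2"
    unfolding cmod_power2 by (simp add: power2_eq_square)
  finally have K: "gauss_curvature X z = - (cmod H)\<^sup>2 / (e\<^sup>2 * e\<^sup>2)" .
  have A: "area_density X z = e\<^sup>2"
    unfolding area_density_def first_fundamental_form[OF assms] e_def[symmetric]
    by (rule real_sqrt_unique) (simp_all add: power2_eq_square)
  have "gauss_curvature X z * area_density X z = - ((cmod H)\<^sup>2 / e\<^sup>2)"
    unfolding K A using e by (simp add: field_simps)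
  also have "(cmod H)\<^sup>2 / e\<^sup>2 = 4 * (cmod W)\<^sup>2 / (N z)\<^sup>2"
    using s_nonzero[OF assms] N_pos[OF assms]
    by (simp add: H_def e_def norm_mult power_mult_distrib field_simps)
  finally show ?thesis by (simp add: W_def)
qed

lemma gauss_map_X:
  assumes "z \<in> S"
  shows "gauss_map X z = (if p z = 0 then Infty else Fin (q z / p z))"
proof -
  define n where "n = unit_normal X z"
  have N: "N z > 0" by (rule N_pos[OF assms])
  have n: "n $ 1 = 2 * Re (q z * cnj (p z)) / N z" "n $ 2 = 2 * Im (q z * cnj (p z)) / N z"
      "n $ 3 = ((cmod (q z))\<^sup>2 - (cmod (p z))\<^sup>2) / N z"
    by (simp_all add: n_def unit_normal_X[OF assms] spinor_normal_def divide_inverse mult_ac)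
  have n3: "1 - n $ 3 = 2 * (cmod (p z))\<^sup>2 / N z"
  proof -
    have "1 - n $ 3 = (N z - ((cmod (q z))\<^sup>2 - (cmod (p z))\<^sup>2)) / N z"
      using N by (simp add: n diff_divide_distrib)
    also have "N z - ((cmod (q z))\<^sup>2 - (cmod (p z))\<^sup>2) = 2 * (cmod (p z))\<^sup>2"
      by (simp add: spinor_norm_def)
    finally show ?thesis .
  qed
  show ?thesis
  proof (cases "p z = 0")
    case True
    then show ?thesis
      using n3 by (simp add: gauss_map_def stereographic_def n_def)
  next
    case False
    have "n $ 3 \<noteq> 1" using n3 False N by auto
    moreover have "n $ 1 / (1 - n $ 3) = Re (q z * cnj (p z)) / (cmod (p z))\<^sup>2"
        "n $ 2 / (1 - n $ 3) = Im (q z * cnj (p z)) / (cmod (p z))\<^sup>2"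
      unfolding n3 unfolding n using N False by (simp_all del: times_complex.sel)
    then have "n $ 1 / (1 - n $ 3) = Re (q z / p z)" "n $ 2 / (1 - n $ 3) = Im (q z / p z)"
      by (simp_all add: complex_div_cnj[of "q z"] Re_divide_of_real Im_divide_of_real
            del: of_real_power times_complex.sel flip: of_real_power)
    ultimately show ?thesis
      using False by (simp add: gauss_map_def stereographic_def n_def[symmetric])
  qed
qed

text \<open>
  The differential multiplies lengths by the positive metric factor, so it is injective.
\<close>

lemma minimal_surface_X: "minimal_surface S X"
  unfolding minimal_surface_def
proof (intro conjI ballI)
  show "smooth_surface_on S X"
    by (rule smooth_surface_on_re_primitive[OF open_S holomorphic_spinor_form X_derivative])
  fix z assume z: "z \<in> S"
  show "mean_curvature X z = 0" by (rule mean_curvature_zero[OF z])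
  have "linear (frechet_derivative X (at z))"
    by (rule linear_frechet_derivative) (use X_derivative[OF z] in \<open>auto simp: differentiable_def\<close>)
  moreover have "v = 0" if "frechet_derivative X (at z) v = 0" for v
  proof -
    have "cmod v * (cmod (s z) * N z) = 0"
      using norm_dir_deriv_X[OF z, of v] that by (simp add: dir_deriv_def)
    then show ?thesis using speed_pos[OF z] by auto
  qed
  ultimately show "inj (frechet_derivative X (at z))"
    using linear_injective_0 by blast
qed (rule open_S connected_S)+

lemma isCont_spinor:
  assumes "z \<in> S"
  shows "isCont p z" "isCont q z"
  using holomorphic_on_imp_continuous_on[OF holomorphic_p] holomorphic_on_imp_continuous_on[OF holomorphic_q]
    assms open_S by (auto simp: continuous_on_eq_continuous_at)

lemma gauss_map_X_sphere_value:
  assumes "z \<in> S" "\<forall>\<^sub>F w in at z. p w \<noteq> 0"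
  shows "gauss_map X z = sphere_value (\<lambda>z. q z / p z) z"
  unfolding gauss_map_X[OF assms(1)]
  by (rule sphere_value_quotient[OF isCont_spinor[OF assms(1)] spinor_nonzero[OF assms(1)] assms(2), symmetric])

lemma nicely_meromorphic_gauss_map:
  assumes "\<And>z. z \<in> S \<Longrightarrow> \<forall>\<^sub>F w in at z. p w \<noteq> 0"
  shows "(\<lambda>z. q z / p z) nicely_meromorphic_on S"
  unfolding nicely_meromorphic_on_def
proof (intro conjI ballI)
  have "p analytic_on S" "q analytic_on S"
    using holomorphic_p holomorphic_q open_S by (auto simp: analytic_on_open)
  then show "(\<lambda>z. q z / p z) meromorphic_on S"
    by (intro meromorphic_intros analytic_on_imp_meromorphic_on)
  fix z assume z: "z \<in> S"
  show "is_pole (\<lambda>z. q z / p z) z \<and> q z / p z = 0 \<or> (\<lambda>z. q z / p z) \<midarrow>z\<rightarrow> q z / p z"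
    using is_pole_quotient[OF isCont_spinor[OF z] _ _ assms[OF z]]
      not_is_pole_quotient(1)[OF isCont_spinor[OF z]] spinor_nonzero[OF z]
    by (cases "p z = 0") auto
qed

text \<open>
  At a zero of \<open>p\<close> the formula in \<open>g\<close> and \<open>h\<close> has a removable singularity, and the spinor form is its
  continuous extension.
\<close>

lemma weierstrass_form_eq:
  assumes "z \<in> S" "\<forall>\<^sub>F w in at z. p w \<noteq> 0"
  shows "weierstrass_form (\<lambda>z. q z / p z) (\<lambda>z. s z * (p z)\<^sup>2) i z = spinor_form p q s i z / 2"
  unfolding weierstrass_form_def
proof (rule remove_sings_eqI)
  let ?f = "\<lambda>z. (vector [1 / 2 * (1 - (q z / p z)\<^sup>2) * (s z * (p z)\<^sup>2),
                     \<i> / 2 * (1 + (q z / p z)\<^sup>2) * (s z * (p z)\<^sup>2),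
                     q z / p z * (s z * (p z)\<^sup>2)] :: complex ^ 3) $ i"
  have "continuous_on S (\<lambda>z. spinor_form p q s i z / 2)"
    by (intro holomorphic_on_imp_continuous_on holomorphic_intros holomorphic_spinor_form) simp
  then have "(\<lambda>z. spinor_form p q s i z / 2) \<midarrow>z\<rightarrow> spinor_form p q s i z / 2"
    using assms(1) open_S by (simp add: continuous_on_eq_continuous_at isCont_def)
  moreover have "\<forall>\<^sub>F w in at z. spinor_form p q s i w / 2 = ?f w"
    using assms(2)
  proof eventually_elim
    case (elim w)
    have "\<forall>i. spinor_form p q s i w / 2 = (vector [1 / 2 * (1 - (q w / p w)\<^sup>2) * (s w * (p w)\<^sup>2),
                     \<i> / 2 * (1 + (q w / p w)\<^sup>2) * (s w * (p w)\<^sup>2),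
                     q w / p w * (s w * (p w)\<^sup>2)] :: complex ^ 3) $ i"
      using elim unfolding forall_3 spinor_form_def null_vector_simps
      by (simp add: field_simps power2_eq_square)
    then show ?case by blast
  qed
  ultimately show "?f \<midarrow>z\<rightarrow> spinor_form p q s i z / 2"
    by (rule Lim_transform_eventually)
qed

lemma weierstrass_data_X:
  assumes "\<And>z. z \<in> S \<Longrightarrow> \<forall>\<^sub>F w in at z. p w \<noteq> 0" and "S \<noteq> {}"
  shows "weierstrass_data S (\<lambda>z. q z / p z) (\<lambda>z. s z * (p z)\<^sup>2) X"
proof -
  let ?\<phi> = "weierstrass_form (\<lambda>z. q z / p z) (\<lambda>z. s z * (p z)\<^sup>2)"
  have \<phi>: "?\<phi> i z = spinor_form p q s i z / 2" if "z \<in> S" for i z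
    using that assms by (intro weierstrass_form_eq)
  have "(\<lambda>z. spinor_form p q s i z / 2) holomorphic_on S" for i
    by (intro holomorphic_intros holomorphic_spinor_form) simp
  then have hol: "?\<phi> i holomorphic_on S" for i
    by (rule holomorphic_transform) (simp add: \<phi>)
  have X_nth: "((\<lambda>z. X z $ i) has_derivative (\<lambda>v. Re (v * (2 * ?\<phi> i z)))) (at z)" if "z \<in> S" for i z
  proof -
    have "2 * ?\<phi> i z = spinor_form p q s i z" by (simp add: \<phi>[OF that])
    then show ?thesis
      using bounded_linear.has_derivative[OF bounded_linear_vec_nth X_derivative[OF that], of i]
      by (simp only: re_vec_nth)
  qed
  have period: "Re (contour_integral c (\<lambda>z. 2 * ?\<phi> i z)) = X (pathfinish c) $ i - X (pathstart c) $ i"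
    if "valid_path c" "path_image c \<subseteq> S" for c i
    by (rule Re_contour_integral_re_primitive[OF open_S _ that X_nth]) (intro holomorphic_intros hol)
  show ?thesis
    unfolding weierstrass_data_def
  proof (intro conjI allI impI ballI)
    show "(\<lambda>z. q z / p z) nicely_meromorphic_on S"
      by (rule nicely_meromorphic_gauss_map[OF assms(1)])
    show "(\<lambda>z. s z * (p z)\<^sup>2) holomorphic_on S"
      by (intro holomorphic_intros holomorphic_s holomorphic_p)
    show "?\<phi> i holomorphic_on S" for i by (rule hol)
    show "\<exists>i. ?\<phi> i z \<noteq> 0" if "z \<in> S" for z
    proof (rule ccontr)
      assume "\<nexists>i. ?\<phi> i z \<noteq> 0"
      then have "\<forall>i. null_vector (p z) (q z) i = 0"
        using \<phi>[OF that] s_nonzero[OF that] by (auto simp: spinor_form_def)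
      then have "2 * (N z)\<^sup>2 = 0"
        unfolding sum_norm_null_vector[symmetric] by simp
      then show False using N_pos[OF that] by simp
    qed
    fix c :: "real \<Rightarrow> complex" and i
    assume c: "valid_path c \<and> pathfinish c = pathstart c \<and> path_image c \<subseteq> S"
    then have "Re (contour_integral c (\<lambda>z. 2 * ?\<phi> i z)) = 0"
      by (simp add: period)
    moreover have "?\<phi> i contour_integrable_on c"
      using c hol open_S by (intro contour_integrable_holomorphic_simple) auto
    ultimately show "Re (contour_integral c (?\<phi> i)) = 0"
      by (simp add: contour_integral_lmul)
  next
    obtain z0 where "z0 \<in> S" using \<open>S \<noteq> {}\<close> by blast
    then show "\<exists>z0\<in>S. \<exists>x0. \<forall>\<gamma>. valid_path \<gamma> \<and> path_image \<gamma> \<subseteq> S \<and> pathstart \<gamma> = z0 \<longrightarrow>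
        X (pathfinish \<gamma>) = x0 + (\<chi> i. Re (contour_integral \<gamma> (\<lambda>z. 2 * ?\<phi> i z)))"
      by (intro bexI[of _ z0] exI[of _ "X z0"]) (auto simp: vec_eq_iff period)
  qed
qed

end

section \<open>Completeness\<close>

text \<open>
  The integral on the right has to be treated as a lower integral until measurability is known.
  Continuity of the velocity outside a finite set gives a Borel measurable integrand there, and the
  remaining parameters do not contribute.
\<close>

lemma primitive_increment_le_length:
  fixes \<gamma> :: "real \<Rightarrow> complex" and f f' :: "complex \<Rightarrow> complex"
  assumes "0 \<le> t" "\<gamma> piecewise_C1_differentiable_on {0..t}" "\<gamma> ` {0..t} \<subseteq> S"
    and f: "\<And>z. z \<in> S \<Longrightarrow> (f has_field_derivative f' z) (at z)"
    and f': "continuous_on S f'"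
  shows "ennreal (cmod (f (\<gamma> t) - f (\<gamma> 0))) \<le>
    (\<integral>\<^sup>+x\<in>{0..t}. ennreal (cmod (f' (\<gamma> x) * vector_derivative \<gamma> (at x))) \<partial>lborel)"
proof -
  let ?k = "\<lambda>x. f' (\<gamma> x) * vector_derivative \<gamma> (at x)"
  obtain T where T: "finite T" "\<gamma> C1_differentiable_on {0..t} - T" and cont: "continuous_on {0..t} \<gamma>"
    using assms(2) by (auto simp: piecewise_C1_differentiable_on_def)
  define U where "U = {0..t} - T"
  have S: "\<gamma> x \<in> S" if "x \<in> {0..t}" for x
    using assms(3) that by auto
  have dU: "\<And>x. x \<in> U \<Longrightarrow> \<gamma> differentiable at x" and cU: "continuous_on U (\<lambda>x. vector_derivative \<gamma> (at x))"
    using T(2) by (auto simp: C1_differentiable_on_eq U_def)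
  have U: "U \<in> sets borel" "U \<subseteq> {0..t}"
    using T(1) by (auto simp: U_def intro: sets.Diff borel_closed finite_imp_closed)
  have "(?k has_integral (f (\<gamma> t) - f (\<gamma> 0))) {0..t}"
  proof (rule fundamental_theorem_of_calculus_interior_strong[OF \<open>finite T\<close> \<open>0 \<le> t\<close>])
    have "continuous_on S f"
      using f by (meson DERIV_continuous continuous_at_imp_continuous_on)
    then show "continuous_on {0..t} (\<lambda>x. f (\<gamma> x))"
      using cont S by (auto intro!: continuous_on_compose2[of S f])
    fix x assume x: "x \<in> {0<..<t} - T"
    then have "(\<gamma> has_vector_derivative vector_derivative \<gamma> (at x)) (at x)"
      using dU[of x] by (simp add: vector_derivative_works U_def)
    from field_vector_diff_chain_at[OF this f[OF S]] x
    show "((\<lambda>x. f (\<gamma> x)) has_vector_derivative ?k x) (at x)"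
      by (simp add: o_def mult.commute)
  qed
  then have int: "(?k has_integral (f (\<gamma> t) - f (\<gamma> 0))) U"
    by (subst (asm) has_integral_spike_set_eq[of _ U])
       (use T(1) in \<open>auto simp: U_def intro: negligible_subset[OF negligible_finite[of T]]\<close>)
  have "continuous_on U ?k"
    using U(2) S by (intro continuous_intros cU continuous_on_compose2[OF f' continuous_on_subset[OF cont]]) auto
  then have meas: "(\<lambda>x. indicator U x *\<^sub>R ?k x) \<in> borel_measurable borel"
    by (rule borel_measurable_continuous_on_indicator[OF U(1)])
  have le: "(\<integral>\<^sup>+x. ennreal (cmod (indicator U x *\<^sub>R ?k x)) \<partial>lborel) \<le>
      (\<integral>\<^sup>+x\<in>{0..t}. ennreal (cmod (?k x)) \<partial>lborel)"
    by (rule nn_integral_mono) (use U(2) in \<open>auto simp: indicator_def\<close>)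
  show ?thesis
  proof (cases "(\<integral>\<^sup>+x\<in>{0..t}. ennreal (cmod (?k x)) \<partial>lborel) = \<infinity>")
    case True
    then show ?thesis by simp
  next
    case False
    then have "(\<integral>\<^sup>+x. ennreal (cmod (indicator U x *\<^sub>R ?k x)) \<partial>lborel) < \<infinity>"
      using le by (simp add: less_top[symmetric] top_unique) (metis top_unique)
    then have ki: "set_integrable lborel U ?k"
      unfolding set_integrable_def using meas by (intro integrableI_bounded) auto
    have "f (\<gamma> t) - f (\<gamma> 0) = (LINT x:U|lborel. ?k x)"
      using has_integral_unique[OF int] has_integral_set_lebesgue set_borel_integral_eq_integral(2)[OF ki]
      by (metis int integral_unique)
    then have "ennreal (cmod (f (\<gamma> t) - f (\<gamma> 0))) \<le>
        (\<integral>\<^sup>+x. ennreal (cmod (indicator U x *\<^sub>R ?k x)) \<partial>lborel)"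
      unfolding set_lebesgue_integral_def
      using ki[unfolded set_integrable_def] integral_norm_bound_ennreal by metis
    then show ?thesis using le by (rule order_trans)
  qed
qed

context spinor_surface
begin

text \<open>
  If the metric dominates \<open>|f'|\<close> for each of the functions \<open>f\<close>, then on a path of finite length all of
  them are bounded.  When joint boundedness confines a point to a compact set, no divergent path can have
  finite length.
\<close>

lemma complete_surface_if_dominated_exhaustion:
  fixes f f' :: "'j \<Rightarrow> complex \<Rightarrow> complex"
  assumes "C > 0"
    and f: "\<And>j z. j \<in> J \<Longrightarrow> z \<in> S \<Longrightarrow> (f j has_field_derivative f' j z) (at z)"
    and f': "\<And>j. j \<in> J \<Longrightarrow> continuous_on S (f' j)"
    and dom: "\<And>j z. j \<in> J \<Longrightarrow> z \<in> S \<Longrightarrow> cmod (f' j z) \<le> C * (cmod (s z) * N z)"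
    and exh: "\<And>M. compact {z\<in>S. \<forall>j\<in>J. cmod (f j z) \<le> M j}"
  shows "complete_surface S X"
  unfolding complete_surface_def
proof (intro allI impI, rule ccontr)
  fix \<gamma> assume \<gamma>: "divergent_path S \<gamma>" and fin: "induced_length X \<gamma> \<noteq> \<infinity>"
  define L where "L = enn2real (induced_length X \<gamma>)"
  have L: "induced_length X \<gamma> = ennreal L" "L \<ge> 0"
    using fin by (auto simp: L_def less_top)
  have \<gamma>S: "\<gamma> x \<in> S" if "0 \<le> x" "x < 1" for x
    using \<gamma> that by (auto simp: divergent_path_def)
  define M where "M j = cmod (f j (\<gamma> 0)) + C * L" for j
  have bound: "cmod (f j (\<gamma> t)) \<le> M j" if "0 \<le> t" "t < 1" "j \<in> J" for t j
  proof -
    \<comment> \<open>Dividing by \<open>C\<close> first avoids moving a constant through the integral, which needs measurability.\<close>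
    have "ennreal (cmod (f j (\<gamma> t) / C - f j (\<gamma> 0) / C)) \<le>
        (\<integral>\<^sup>+x\<in>{0..t}. ennreal (cmod (f' j (\<gamma> x) / C * vector_derivative \<gamma> (at x))) \<partial>lborel)"
    proof (rule primitive_increment_le_length)
      show "\<gamma> piecewise_C1_differentiable_on {0..t}" "\<gamma> ` {0..t} \<subseteq> S"
        using \<gamma> that \<gamma>S by (auto simp: divergent_path_def)
      show "((\<lambda>z. f j z / C) has_field_derivative f' j z / C) (at z)" if "z \<in> S" for z
        by (rule DERIV_cdivide[OF f[OF \<open>j \<in> J\<close> that]])
      show "continuous_on S (\<lambda>z. f' j z / C)"
        using f'[OF \<open>j \<in> J\<close>] \<open>C > 0\<close> by (intro continuous_intros) auto
    qed fact
    also have "\<dots> \<le> induced_length X \<gamma>"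
      unfolding induced_length_def
    proof (rule nn_integral_mono)
      fix x
      show "ennreal (cmod (f' j (\<gamma> x) / C * vector_derivative \<gamma> (at x))) * indicator {0..t} x \<le>
          ennreal (norm (dir_deriv (vector_derivative \<gamma> (at x)) X (\<gamma> x))) * indicator {0..<1} x"
      proof (cases "x \<in> {0..t}")
        case True
        then have x: "x \<in> {0..<1}" "\<gamma> x \<in> S" using that \<gamma>S by auto
        have "cmod (f' j (\<gamma> x) / C) \<le> cmod (s (\<gamma> x)) * N (\<gamma> x)"
          using dom[OF \<open>j \<in> J\<close> x(2)] \<open>C > 0\<close> by (simp add: norm_divide divide_simps mult_ac)
        then have "cmod (f' j (\<gamma> x) / C) * cmod (vector_derivative \<gamma> (at x)) \<le>
            cmod (s (\<gamma> x)) * N (\<gamma> x) * cmod (vector_derivative \<gamma> (at x))"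
          by (rule mult_right_mono) simp
        then show ?thesis
          unfolding norm_dir_deriv_X[OF x(2)] norm_mult using True x(1)
          by (auto simp: mult_ac intro!: ennreal_leI)
      qed simp
    qed
    finally have "cmod (f j (\<gamma> t) / C - f j (\<gamma> 0) / C) \<le> L"
      using L by simp
    then have "cmod (f j (\<gamma> t) - f j (\<gamma> 0)) \<le> C * L"
      using \<open>C > 0\<close> by (simp add: norm_divide divide_simps mult_ac flip: diff_divide_distrib)
    then show ?thesis
      unfolding M_def using norm_triangle_sub[of "f j (\<gamma> t)" "f j (\<gamma> 0)"] by linarith
  qed
  define K where "K = {z\<in>S. \<forall>j\<in>J. cmod (f j z) \<le> M j}"
  have "compact K" "K \<subseteq> S" using exh by (auto simp: K_def)
  then have "\<forall>\<^sub>F t in at_left 1. \<gamma> t \<notin> K"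
    using \<gamma> by (auto simp: divergent_path_def)
  moreover have "\<forall>\<^sub>F t in at_left 1. t \<in> {0<..<1::real}"
    by (rule eventually_at_left_real) simp
  ultimately have "\<forall>\<^sub>F t in at_left (1::real). False"
    by eventually_elim (use bound \<gamma>S in \<open>auto simp: K_def\<close>)
  then show False by simp
qed

end

section \<open>Finite total curvature\<close>

text \<open>
  Since \<open>(1 + x\<^sup>2) (1 + y\<^sup>2) \<le> (1 + x\<^sup>2 + y\<^sup>2)\<^sup>2\<close>, Tonelli's theorem reduces the claim to the integral of
  \<open>1 / (1 + x\<^sup>2)\<close> over the real line.
\<close>

lemma integrable_inverse_square_1_plus_norm_square:
  "integrable lborel (\<lambda>z::complex. inverse ((1 + (cmod z)\<^sup>2)\<^sup>2))"
proof (rule Bochner_Integration.integrable_bound)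
  have Basis: "(\<Prod>b\<in>Basis. F b) = F 1 * F \<i>" for F :: "complex \<Rightarrow> 'a::comm_monoid_mult"
    by (simp add: Basis_complex_def complex_eq_iff)
  let ?k = "\<lambda>x::real. inverse (1 + x\<^sup>2)"
  have "integrable lborel ?k"
    using integrable_inverse_1_plus_square by (simp add: set_integrable_def)
  then have fin: "(\<integral>\<^sup>+x. ennreal (?k x) \<partial>lborel) < \<infinity>"
    by (simp add: integrable_iff_bounded add_nonneg_nonneg)
  have "(\<integral>\<^sup>+z. (\<Prod>b\<in>Basis. ennreal (?k ((z :: complex) \<bullet> b))) \<partial>lborel) = (\<Prod>b\<in>(Basis::complex set). \<integral>\<^sup>+x. ennreal (?k x) \<partial>lborel)"
    by (rule nn_integral_lborel_prod) auto
  then have "(\<integral>\<^sup>+z. ennreal (?k (Re z) * ?k (Im z)) \<partial>lborel) = (\<integral>\<^sup>+x. ennreal (?k x) \<partial>lborel) * (\<integral>\<^sup>+x. ennreal (?k x) \<partial>lborel)"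
    unfolding Basis by (simp add: ennreal_mult)
  also have "\<dots> < \<infinity>" using fin by (simp add: ennreal_mult_less_top)
  finally show "integrable lborel (\<lambda>z::complex. ?k (Re z) * ?k (Im z))"
    by (intro integrableI_nonneg) auto
  show "(\<lambda>z::complex. inverse ((1 + (cmod z)\<^sup>2)\<^sup>2)) \<in> borel_measurable lborel"
    by simp
  show "AE z in lborel. norm (inverse ((1 + (cmod z)\<^sup>2)\<^sup>2)) \<le> norm (?k (Re z) * ?k (Im z))"
  proof (rule AE_I2)
    fix z
    have "(1 + (Re z)\<^sup>2) * (1 + (Im z)\<^sup>2) \<le> (1 + (cmod z)\<^sup>2) * (1 + (cmod z)\<^sup>2)"
      by (rule mult_mono) (auto simp: cmod_power2)
    moreover have "(1 + (Re z)\<^sup>2) * (1 + (Im z)\<^sup>2) > 0" by (simp add: add_pos_nonneg)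
    ultimately have "inverse ((1 + (cmod z)\<^sup>2)\<^sup>2) \<le> inverse ((1 + (Re z)\<^sup>2) * (1 + (Im z)\<^sup>2))"
      unfolding power2_eq_square[of "1 + _"] by (rule le_imp_inverse_le)
    then show "norm (inverse ((1 + (cmod z)\<^sup>2)\<^sup>2)) \<le> norm (?k (Re z) * ?k (Im z))"
      by (simp add: abs_mult)
  qed
qed

context spinor_surface
begin

text \<open>
  The quotient in the last assumption is half the square root of the absolute curvature density.
\<close>

lemma finite_total_curvature_if_bounded:
  assumes cont: "continuous_on UNIV W" "continuous_on UNIV p" "continuous_on UNIV q"
    and W: "\<And>z. z \<in> S \<Longrightarrow> deriv p z * q z - p z * deriv q z = W z"
    and nz: "\<And>z. p z \<noteq> 0 \<or> q z \<noteq> 0"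
    and bound: "\<And>z. cmod (W z) / N z \<le> C / (1 + (cmod z)\<^sup>2)"
  shows "finite_total_curvature S X"
proof -
  have Nnz: "N z > 0" for z by (rule spinor_norm_pos[OF nz])
  have "integrable lborel (\<lambda>z. - (4 * (cmod (W z))\<^sup>2 / (N z)\<^sup>2))"
  proof (rule Bochner_Integration.integrable_bound)
    show "integrable lborel (\<lambda>z::complex. 4 * C\<^sup>2 * inverse ((1 + (cmod z)\<^sup>2)\<^sup>2))"
      by (intro integrable_mult_right integrable_inverse_square_1_plus_norm_square)
    have "continuous_on UNIV (\<lambda>z. - (4 * (cmod (W z))\<^sup>2 / (N z)\<^sup>2))"
      using Nnz cont unfolding spinor_norm_def by (intro continuous_intros) (auto simp: less_le)
    then have "(\<lambda>z. - (4 * (cmod (W z))\<^sup>2 / (N z)\<^sup>2)) \<in> borel_measurable borel"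
      by (rule borel_measurable_continuous_onI)
    then show "(\<lambda>z. - (4 * (cmod (W z))\<^sup>2 / (N z)\<^sup>2)) \<in> borel_measurable lborel"
      by simp
    show "AE z in lborel. norm (- (4 * (cmod (W z))\<^sup>2 / (N z)\<^sup>2)) \<le> norm (4 * C\<^sup>2 * inverse ((1 + (cmod z)\<^sup>2)\<^sup>2))"
    proof (rule AE_I2)
      fix z
      have "(cmod (W z) / N z)\<^sup>2 \<le> (C / (1 + (cmod z)\<^sup>2))\<^sup>2"
        using bound[of z] Nnz[of z] by (intro power_mono) auto
      then show "norm (- (4 * (cmod (W z))\<^sup>2 / (N z)\<^sup>2)) \<le> norm (4 * C\<^sup>2 * inverse ((1 + (cmod z)\<^sup>2)\<^sup>2))"
        by (simp add: power_divide power_mult_distrib divide_inverse power_inverse)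
    qed
  qed
  moreover have "S \<in> sets lborel" using open_S by simp
  ultimately have "set_integrable lborel S (\<lambda>z. - (4 * (cmod (W z))\<^sup>2 / (N z)\<^sup>2))"
    unfolding set_integrable_def by (rule integrable_mult_indicator[rotated])
  then show ?thesis
    unfolding finite_total_curvature_def
    by (subst set_integrable_cong[OF refl, of S]) (simp_all add: curvature_form W)
qed

end

section \<open>Explicit primitives\<close>

text \<open>
  With \<open>T = z\<^sup>2 + 1\<close> one has \<open>z\<^sup>6/T\<^sup>2 = z\<^sup>2 - 2 + 3/T - 1/T\<^sup>2\<close>, \<open>z\<^sup>2/T = 1 - 1/T\<close>, and \<open>1/T\<^sup>2\<close> is the sum of
  \<open>1/(2T)\<close> and the derivative of \<open>z/(2T)\<close>.  So \<open>x z\<^sup>6/T\<^sup>2 + y z\<^sup>2/T + w/z\<^sup>2\<close> has the rational primitive in the first line up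
  to the integral of \<open>(5x/2 - y)/T\<close>, where \<open>1/T = (1/(z - \<i>) - 1/(z + \<i>))/(2\<i>)\<close>.
\<close>

definition primitive_part :: "complex \<Rightarrow> complex \<Rightarrow> complex \<Rightarrow> complex \<Rightarrow> real" where
  "primitive_part x y w z =
     Re (x * (z ^ 3 / 3 - 2 * z - z / (2 * (z\<^sup>2 + 1))) + y * z - w / z) +
     Im (5 / 2 * x - y) / 2 * (ln (cmod (z - \<i>)) - ln (cmod (z - (- \<i>))))"

lemma square_plus_one_eq_0_iff: "z\<^sup>2 + 1 = 0 \<longleftrightarrow> z = \<i> \<or> z = - \<i>" for z :: complex
proof -
  have "z\<^sup>2 + 1 = (z - \<i>) * (z + \<i>)"
    by (simp add: power2_eq_square algebra_simps)
  then show ?thesis by (simp add: add_eq_0_iff2)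
qed

text \<open>
  The hypothesis on \<open>5x/2 - y\<close> makes the residues at \<open>\<plusminus>\<i>\<close> real, so that only the moduli of
  \<open>z - \<i>\<close> and \<open>z + \<i>\<close> enter the real part of the logarithms.
\<close>

lemma has_derivative_primitive_part:
  assumes z: "z \<noteq> 0" "z \<noteq> \<i>" "z \<noteq> - \<i>" and res: "Re (5 / 2 * x - y) = 0"
  shows "(primitive_part x y w has_derivative
    (\<lambda>v. Re (v * (x * (z ^ 6 / (z\<^sup>2 + 1)\<^sup>2) + y * (z\<^sup>2 / (z\<^sup>2 + 1)) + w / z\<^sup>2)))) (at z)"
proof -
  define T where "T = z\<^sup>2 + 1"
  have T: "T \<noteq> 0" using z by (simp add: T_def square_plus_one_eq_0_iff)
  define k where "k = Im (5 / 2 * x - y) / 2"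
  let ?R' = "x * (z\<^sup>2 - 2 - (1 / (2 * T) - z\<^sup>2 / T\<^sup>2)) + y + w / z\<^sup>2"
  have "((\<lambda>z. 2 * (z\<^sup>2 + 1)) has_field_derivative 4 * z) (at z)"
    by (auto intro!: derivative_eq_intros)
  from DERIV_divide[OF DERIV_ident this] T
  have "((\<lambda>z. z / (2 * (z\<^sup>2 + 1))) has_field_derivative (2 * T - 4 * z\<^sup>2) / (4 * T\<^sup>2)) (at z)"
    unfolding T_def[symmetric] by (simp add: power2_eq_square mult_ac)
  moreover have "(2 * T - 4 * z\<^sup>2) / (4 * T\<^sup>2) = 1 / (2 * T) - z\<^sup>2 / T\<^sup>2"
    using T by (simp add: diff_divide_distrib power2_eq_square[of T])
  ultimately have h: "((\<lambda>z. z / (2 * (z\<^sup>2 + 1))) has_field_derivative 1 / (2 * T) - z\<^sup>2 / T\<^sup>2) (at z)"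
    by (simp only:)
  have "((\<lambda>z. x * (z ^ 3 / 3 - 2 * z - H z) + y * z - w / z) has_field_derivative
      x * (z\<^sup>2 - 2 - d) + y + w / z\<^sup>2) (at z)" if "(H has_field_derivative d) (at z)" for H d
    using z(1) by (auto intro!: derivative_eq_intros that simp: power2_eq_square)
  from this[OF h]
  have "((\<lambda>z. x * (z ^ 3 / 3 - 2 * z - z / (2 * (z\<^sup>2 + 1))) + y * z - w / z) has_field_derivative ?R') (at z)" .
  then have "((\<lambda>z. Re (x * (z ^ 3 / 3 - 2 * z - z / (2 * (z\<^sup>2 + 1))) + y * z - w / z)) has_derivative
      (\<lambda>v. Re (?R' * v))) (at z)"
    unfolding has_field_derivative_def by (rule has_derivative_Re)
  moreover have "((\<lambda>z. k * (ln (cmod (z - \<i>)) - ln (cmod (z - (- \<i>))))) has_derivative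
      (\<lambda>v. k * (Re (v / (z - \<i>)) - Re (v / (z - (- \<i>)))))) (at z)"
    by (intro has_derivative_mult_right has_derivative_diff has_derivative_ln_norm_diff) (use z in auto)
  ultimately have D: "(primitive_part x y w has_derivative
      (\<lambda>v. Re (?R' * v) + k * (Re (v / (z - \<i>)) - Re (v / (z - (- \<i>)))))) (at z)"
    unfolding primitive_part_def[abs_def] k_def[symmetric] by (rule has_derivative_add)
  have eq: "Re (?R' * v) + k * (Re (v / (z - \<i>)) - Re (v / (z - (- \<i>)))) =
      Re (v * (x * (z ^ 6 / T\<^sup>2) + y * (z\<^sup>2 / T) + w / z\<^sup>2))" for v
  proof -
    have xy: "5 / 2 * x - y = 2 * \<i> * of_real k"
      using res by (simp add: complex_eq_iff k_def)
    have nz: "z - \<i> \<noteq> 0" "z - (- \<i>) \<noteq> 0" using z(2,3) by (simp_all only: right_minus_eq not_False_eq_True)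
    have "1 / (z - \<i>) - 1 / (z - (- \<i>)) = 2 * \<i> / ((z - \<i>) * (z - (- \<i>)))"
      unfolding diff_frac_eq[OF nz] by simp
    also have "(z - \<i>) * (z - (- \<i>)) = T"
      by (simp add: T_def power2_eq_square algebra_simps)
    finally have d: "1 / (z - \<i>) - 1 / (z - (- \<i>)) = 2 * \<i> / T" .
    have "of_real k * (v / (z - \<i>) - v / (z - (- \<i>))) =
        of_real k * v * (1 / (z - \<i>) - 1 / (z - (- \<i>)))"
      by (simp add: right_diff_distrib)
    also have "\<dots> = v * ((5 / 2 * x - y) / T)"
      unfolding d xy by simp
    finally have "?R' * v + of_real k * (v / (z - \<i>) - v / (z - (- \<i>))) = v * (?R' + (5 / 2 * x - y) / T)"
      by (simp only: distrib_left mult.commute[of ?R' v])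
    also have "?R' + (5 / 2 * x - y) / T = x * (z ^ 6 / T\<^sup>2) + y * (z\<^sup>2 / T) + w / z\<^sup>2"
    proof -
      have z2: "z\<^sup>2 = T - 1" by (simp add: T_def)
      have z6: "z ^ 6 = (T - 1) ^ 3" unfolding z2[symmetric] by (simp flip: power_mult)
      have "x * (T - 1 - 2 - (1 / (2 * T) - (T - 1) / T\<^sup>2)) + y + (5 / 2 * x - y) / T =
          x * ((T - 1) ^ 3 / T\<^sup>2) + y * ((T - 1) / T)"
        using T by (simp add: field_simps power2_eq_square power3_eq_cube)
      from arg_cong[OF this, of "\<lambda>t. t + w / (T - 1)"] show ?thesis
        unfolding z6 z2 by (simp only: add.assoc add.commute add.left_commute)
    qed
    finally have *: "?R' * v + of_real k * (v / (z - \<i>) - v / (z - (- \<i>))) =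
      v * (x * (z ^ 6 / T\<^sup>2) + y * (z\<^sup>2 / T) + w / z\<^sup>2)" .
    have "Re (R + of_real k * (e - e')) = Re R + k * (Re e - Re e')" for R e e'
      by simp
    from this[of "?R' * v" "v / (z - \<i>)" "v / (z - (- \<i>))"] show ?thesis
      unfolding * by (rule sym)
  qed
  show ?thesis using D unfolding eq unfolding T_def .
qed

section \<open>A pencil of quartics\<close>

text \<open>
  Numerator and denominator of \<open>g\<close>, and hence of each \<open>g - c\<close>, belong to this pencil.
\<close>

definition quartic :: "complex \<Rightarrow> complex \<Rightarrow> complex \<Rightarrow> complex" where
  "quartic \<mu> \<nu> z = \<mu> * z ^ 4 + \<nu> * (z\<^sup>2 + 1)"

lemma holomorphic_quartic [holomorphic_intros]: "quartic \<mu> \<nu> holomorphic_on A"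
  unfolding quartic_def[abs_def] by (intro holomorphic_intros)

lemma continuous_quartic: "continuous_on A (quartic \<mu> \<nu>)"
  by (intro holomorphic_on_imp_continuous_on holomorphic_quartic)

lemma has_field_derivative_quartic: "(quartic \<mu> \<nu> has_field_derivative 4 * \<mu> * z ^ 3 + 2 * \<nu> * z) (at z)"
  unfolding quartic_def[abs_def] by (auto intro!: derivative_eq_intros simp: algebra_simps)

lemma quartic_root_exists:
  assumes "\<mu> \<noteq> 0"
  shows "\<exists>z. quartic \<mu> \<nu> z = 0"
proof -
  define y where "y = (csqrt (\<nu>\<^sup>2 - 4 * \<mu> * \<nu>) - \<nu>) / (2 * \<mu>)"
  have "2 * \<mu> * y + \<nu> = csqrt (\<nu>\<^sup>2 - 4 * \<mu> * \<nu>)" using assms by (simp add: y_def)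
  then have "(2 * \<mu> * y + \<nu>)\<^sup>2 = \<nu>\<^sup>2 - 4 * \<mu> * \<nu>" by simp
  \<comment> \<open>The quartic is quadratic in \<open>y = z\<^sup>2\<close>.\<close>
  then have "4 * \<mu> * (\<mu> * y\<^sup>2 + \<nu> * (y + 1)) = 0"
    by (simp add: power2_eq_square algebra_simps)
  then have "\<mu> * y\<^sup>2 + \<nu> * (y + 1) = 0" using assms by simp
  then have "quartic \<mu> \<nu> (csqrt y) = 0"
    using power_mult[of "csqrt y" 2 2] by (simp add: quartic_def)
  then show ?thesis ..
qed

lemma quartic_root_factor:
  assumes "quartic \<mu> \<nu> z = 0"
  shows "quartic \<mu> \<nu> w = (w - z) * ((w + z) * (\<mu> * (w\<^sup>2 + z\<^sup>2) + \<nu>))"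
proof -
  have "quartic \<mu> \<nu> w = quartic \<mu> \<nu> w - quartic \<mu> \<nu> z" using assms by simp
  also have "\<dots> = (w - z) * ((w + z) * (\<mu> * (w\<^sup>2 + z\<^sup>2) + \<nu>))"
    by (simp add: quartic_def power2_eq_square power4_eq_xxxx algebra_simps)
  finally show ?thesis .
qed

text \<open>
  The product is the derivative of the quartic at its root \<open>z\<close>.  As \<open>\<nu> \<noteq> 0\<close> excludes \<open>z = 0\<close>, both can
  vanish only if \<open>z\<^sup>2 = -2\<close>, which forces \<open>\<nu> = 4 \<mu>\<close>.
\<close>

lemma quartic_root_simple:
  assumes "quartic \<mu> \<nu> z = 0" "\<mu> \<noteq> 0" "\<nu> \<noteq> 0" "\<nu> \<noteq> 4 * \<mu>"
  shows "(z + z) * (\<mu> * (z\<^sup>2 + z\<^sup>2) + \<nu>) \<noteq> 0"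
proof
  have z: "z \<noteq> 0" using assms(1,3) by (auto simp: quartic_def)
  assume "(z + z) * (\<mu> * (z\<^sup>2 + z\<^sup>2) + \<nu>) = 0"
  then have "\<nu> + \<mu> * (z\<^sup>2 + z\<^sup>2) = 0" using z by (simp add: add.commute)
  then have n: "\<nu> = - (2 * \<mu> * z\<^sup>2)" by (simp add: eq_neg_iff_add_eq_0 mult_ac)
  have "- \<mu> * z\<^sup>2 * (z\<^sup>2 + 2) = 0"
    using assms(1) unfolding quartic_def n by (simp add: power2_eq_square power4_eq_xxxx algebra_simps)
  then have "z\<^sup>2 = - 2" using z assms(2) by (simp add: eq_neg_iff_add_eq_0)
  then show False using n assms(4) by simp
qed

lemma quartic_root_in_domain:
  assumes "quartic \<mu> \<nu> z = 0" "\<mu> \<noteq> 0" "\<nu> \<noteq> 0"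
  shows "z \<notin> {0, \<i>, - \<i>}"
  using assms by (auto simp: quartic_def)

lemma eventually_quartic_nonzero:
  assumes "\<mu> \<noteq> 0" "\<nu> \<noteq> 0" "\<nu> \<noteq> 4 * \<mu>"
  shows "\<forall>\<^sub>F w in at z. quartic \<mu> \<nu> w \<noteq> 0"
proof (cases "quartic \<mu> \<nu> z = 0")
  case False
  have "quartic \<mu> \<nu> \<midarrow>z\<rightarrow> quartic \<mu> \<nu> z"
    using continuous_quartic[of UNIV] by (auto simp: continuous_on_def)
  then show ?thesis by (rule tendsto_imp_eventually_ne[OF _ False])
next
  case True
  have "(\<lambda>w. (w + z) * (\<mu> * (w\<^sup>2 + z\<^sup>2) + \<nu>)) \<midarrow>z\<rightarrow> (z + z) * (\<mu> * (z\<^sup>2 + z\<^sup>2) + \<nu>)"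
    by (intro tendsto_intros)
  then have "\<forall>\<^sub>F w in at z. (w + z) * (\<mu> * (w\<^sup>2 + z\<^sup>2) + \<nu>) \<noteq> 0"
    by (rule tendsto_imp_eventually_ne[OF _ quartic_root_simple[OF True assms]])
  moreover have "\<forall>\<^sub>F w in at z. w \<noteq> z" by (simp add: eventually_at_filter)
  ultimately show ?thesis
    unfolding quartic_root_factor[OF True] by eventually_elim simp
qed

lemma zorder_quotient_simple_zero:
  assumes "quartic \<mu> \<nu> z = 0" "\<mu> \<noteq> 0" "\<nu> \<noteq> 0" "\<nu> \<noteq> 4 * \<mu>"
    and "quartic \<mu>' \<nu>' z \<noteq> 0" "c \<noteq> 0"
    and f: "\<And>w. quartic \<mu>' \<nu>' w \<noteq> 0 \<Longrightarrow> f w = c * quartic \<mu> \<nu> w / quartic \<mu>' \<nu>' w"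
  shows "zorder f z = 1"
proof (rule zorder_eqI[where g = "\<lambda>w. c * ((w + z) * (\<mu> * (w\<^sup>2 + z\<^sup>2) + \<nu>)) / quartic \<mu>' \<nu>' w"])
  show "open {w. quartic \<mu>' \<nu>' w \<noteq> 0}"
    by (intro open_Collect_neq continuous_quartic continuous_on_const)
  show "(\<lambda>w. c * ((w + z) * (\<mu> * (w\<^sup>2 + z\<^sup>2) + \<nu>)) / quartic \<mu>' \<nu>' w)
      holomorphic_on {w. quartic \<mu>' \<nu>' w \<noteq> 0}"
    by (intro holomorphic_intros) auto
  show "c * ((z + z) * (\<mu> * (z\<^sup>2 + z\<^sup>2) + \<nu>)) / quartic \<mu>' \<nu>' z \<noteq> 0"
    using quartic_root_simple[OF assms(1-4)] assms(5,6) by simp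
  fix w assume "w \<in> {w. quartic \<mu>' \<nu>' w \<noteq> 0}"
  then show "f w = c * ((w + z) * (\<mu> * (w\<^sup>2 + z\<^sup>2) + \<nu>)) / quartic \<mu>' \<nu>' w * (w - z) powi 1"
    by (simp add: f quartic_root_factor[OF assms(1), of w])
qed (use assms(5) in simp)

lemma zorder_quotient_simple_pole:
  assumes "quartic \<mu> \<nu> z = 0" "\<mu> \<noteq> 0" "\<nu> \<noteq> 0" "\<nu> \<noteq> 4 * \<mu>"
    and "quartic \<mu>' \<nu>' z \<noteq> 0" "c \<noteq> 0"
  shows "zorder (\<lambda>w. c * quartic \<mu>' \<nu>' w / quartic \<mu> \<nu> w) z = - 1"
proof -
  let ?k = "\<lambda>w. (w + z) * (\<mu> * (w\<^sup>2 + z\<^sup>2) + \<nu>)"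
  show ?thesis
  proof (rule zorder_eqI[where g = "\<lambda>w. c * quartic \<mu>' \<nu>' w / ?k w"])
    show "open {w. ?k w \<noteq> 0}"
      by (intro open_Collect_neq continuous_intros)
    show "(\<lambda>w. c * quartic \<mu>' \<nu>' w / ?k w) holomorphic_on {w. ?k w \<noteq> 0}"
      by (intro holomorphic_intros) auto
    show "z \<in> {w. ?k w \<noteq> 0}" "c * quartic \<mu>' \<nu>' z / ?k z \<noteq> 0"
      using quartic_root_simple[OF assms(1-4)] assms(5,6) by simp_all
    fix w assume "w \<in> {w. ?k w \<noteq> 0}" "w \<noteq> z"
    then show "c * quartic \<mu>' \<nu>' w / quartic \<mu> \<nu> w = c * quartic \<mu>' \<nu>' w / ?k w * (w - z) powi - 1"
      unfolding quartic_root_factor[OF assms(1), of w]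
      by (simp add: power_int_minus divide_inverse mult_ac)
  qed
qed

lemma zorder_quotient_double_zero:
  assumes z: "z\<^sup>2 = - 2" and "quartic \<mu>' \<nu>' z \<noteq> 0" "c \<noteq> 0"
    and f: "\<And>w. quartic \<mu>' \<nu>' w \<noteq> 0 \<Longrightarrow> f w = c * (w\<^sup>2 + 2)\<^sup>2 / quartic \<mu>' \<nu>' w"
  shows "zorder f z = 2"
proof (rule zorder_eqI[where g = "\<lambda>w. c * (w + z)\<^sup>2 / quartic \<mu>' \<nu>' w"])
  show "open {w. quartic \<mu>' \<nu>' w \<noteq> 0}"
    by (intro open_Collect_neq continuous_quartic continuous_on_const)
  show "(\<lambda>w. c * (w + z)\<^sup>2 / quartic \<mu>' \<nu>' w) holomorphic_on {w. quartic \<mu>' \<nu>' w \<noteq> 0}"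
    by (intro holomorphic_intros) auto
  have "z \<noteq> 0" using z by auto
  then show "c * (z + z)\<^sup>2 / quartic \<mu>' \<nu>' z \<noteq> 0" using assms(2,3) by simp
  fix w assume w: "w \<in> {w. quartic \<mu>' \<nu>' w \<noteq> 0}"
  have "w\<^sup>2 + 2 = w\<^sup>2 - z\<^sup>2" by (simp add: z)
  also have "\<dots> = (w + z) * (w - z)" by (simp add: power2_eq_square algebra_simps)
  finally show "f w = c * (w + z)\<^sup>2 / quartic \<mu>' \<nu>' w * (w - z) powi 2"
    using w by (simp add: f power_mult_distrib)
qed (use assms(2) in simp)

section \<open>Ramification of the Gauss map\<close>

lemma quartic_no_common_root:
  assumes "m \<noteq> 0" "n \<noteq> n'"
  shows "quartic m n z \<noteq> 0 \<or> quartic m n' z \<noteq> 0"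
proof (rule ccontr)
  assume *: "\<not> ?thesis"
  have "(n - n') * (z\<^sup>2 + 1) = quartic m n z - quartic m n' z"
    by (simp add: quartic_def algebra_simps)
  with * have "(n - n') * (z\<^sup>2 + 1) = 0" by simp
  then have "z = \<i> \<or> z = - \<i>" using assms by (simp add: square_plus_one_eq_0_iff)
  then show False using * assms by (auto simp: quartic_def)
qed

lemma quartic_linear_combination:
  "c * quartic \<mu> \<nu> z - d * quartic \<mu>' \<nu>' z = quartic (c * \<mu> - d * \<mu>') (c * \<nu> - d * \<nu>') z"
  by (simp add: quartic_def algebra_simps)

context
  fixes m n a b \<sigma> :: complex and S :: "complex set" and g :: "complex \<Rightarrow> complex"
  assumes m: "m \<noteq> 0" and n: "n \<noteq> 0" and n4m: "n \<noteq> 4 * m" and a: "a \<noteq> 1" and b: "b \<noteq> 1" and ab: "a \<noteq> b"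
    and \<sigma>: "\<sigma> \<noteq> 0" and nm: "n * (a - b) = 4 * m * (1 - b)"
    and S_def: "S = UNIV - {0, \<i>, - \<i>}"
    and g_def: "g = (\<lambda>z. \<sigma> * quartic m (n * a) z / quartic m n z)"
begin

lemma sphere_value_g: "sphere_value g z = (if quartic m n z = 0 then Infty else Fin (g z))"
proof -
  have "isCont (quartic m n) z" "isCont (\<lambda>z. \<sigma> * quartic m (n * a) z) z"
    using continuous_quartic[of UNIV]
    by (auto intro!: continuous_intros simp: continuous_on_eq_continuous_at)
  moreover have "quartic m n z \<noteq> 0 \<or> \<sigma> * quartic m (n * a) z \<noteq> 0"
    using quartic_no_common_root[OF m, of n "n * a" z] n a \<sigma> by auto
  ultimately show ?thesis
    unfolding g_def using eventually_quartic_nonzero[OF m n n4m] by (rule sphere_value_quotient)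
qed

lemma g_minus:
  "quartic m n w \<noteq> 0 \<Longrightarrow> g w - c = quartic (m * (\<sigma> - c)) (n * (\<sigma> * a - c)) w / quartic m n w"
proof -
  assume "quartic m n w \<noteq> 0"
  then have "g w - c = (\<sigma> * quartic m (n * a) w - c * quartic m n w) / quartic m n w"
    by (simp add: g_def diff_divide_distrib)
  then show ?thesis
    unfolding quartic_linear_combination by (simp add: algebra_simps)
qed

lemma roots_on_Fin:
  "roots_on S g (Fin c) = {z \<in> S. quartic (m * (\<sigma> - c)) (n * (\<sigma> * a - c)) z = 0}"
proof -
  have "quartic m n z \<noteq> 0" if "quartic (m * (\<sigma> - c)) (n * (\<sigma> * a - c)) z = 0" for z
  proof
    assume *: "quartic m n z = 0"
    have "\<sigma> * quartic m (n * a) z - c * quartic m n z = 0"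
      unfolding quartic_linear_combination using that by (simp add: algebra_simps)
    with * show False
      using quartic_no_common_root[OF m, of n "n * a" z] n a \<sigma> by auto
  qed
  moreover have "g z = c \<longleftrightarrow> quartic (m * (\<sigma> - c)) (n * (\<sigma> * a - c)) z = 0" if "quartic m n z \<noteq> 0" for z
    using g_minus[OF that, of c] that by (metis divide_eq_0_iff right_minus_eq)
  ultimately show ?thesis
    by (auto simp: roots_on_def sphere_value_g)
qed

lemma roots_on_omitted: "roots_on S g (Fin \<sigma>) = {}" "roots_on S g (Fin (\<sigma> * a)) = {}"
proof -
  have *: "n * (\<sigma> * a - \<sigma>) \<noteq> 0" "m * (\<sigma> - \<sigma> * a) \<noteq> 0"
    using m n a \<sigma> by auto
  then show "roots_on S g (Fin \<sigma>) = {}" "roots_on S g (Fin (\<sigma> * a)) = {}"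
    unfolding roots_on_Fin by (auto simp: quartic_def S_def square_plus_one_eq_0_iff)
qed

text \<open>
  The relation between \<open>m\<close>, \<open>n\<close>, \<open>a\<close> and \<open>b\<close> says that \<open>\<nu> = 4 \<mu>\<close> for the value \<open>\<sigma> b\<close>.
\<close>

lemma quartic_b:
  "quartic (m * (\<sigma> - \<sigma> * b)) (n * (\<sigma> * a - \<sigma> * b)) w = \<sigma> * m * (1 - b) * (w\<^sup>2 + 2)\<^sup>2"
proof -
  have "n * (\<sigma> * a - \<sigma> * b) = 4 * (\<sigma> * m * (1 - b))"
    using nm by (simp add: right_diff_distrib[symmetric] mult_ac)
  moreover have "m * (\<sigma> - \<sigma> * b) = \<sigma> * m * (1 - b)" by (simp add: algebra_simps)
  ultimately show ?thesis
    by (simp only: quartic_def) (simp add: power2_eq_square power4_eq_xxxx algebra_simps)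
qed

lemma roots_on_b: "roots_on S g (Fin (\<sigma> * b)) = {z. z\<^sup>2 = - 2}"
proof -
  have "z\<^sup>2 + 2 = 0 \<longleftrightarrow> z\<^sup>2 = - 2" for z :: complex
    by (simp add: eq_neg_iff_add_eq_0)
  moreover have "z \<in> S" if "z\<^sup>2 = - 2" for z
    using that by (auto simp: S_def)
  ultimately show ?thesis
    using \<sigma> m b unfolding roots_on_Fin quartic_b by auto
qed

lemma root_multiplicity_b:
  assumes "z\<^sup>2 = - 2"
  shows "root_multiplicity g (Fin (\<sigma> * b)) z = 2"
proof -
  have "z ^ 4 = (z\<^sup>2)\<^sup>2" by (simp flip: power_mult)
  then have "quartic m n z = 4 * m - n"
    unfolding quartic_def assms by (simp add: assms)
  then have nz: "quartic m n z \<noteq> 0" using n4m by simp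
  have "zorder (\<lambda>w. g w - \<sigma> * b) z = 2"
    using assms nz
  proof (rule zorder_quotient_double_zero)
    show "\<sigma> * m * (1 - b) \<noteq> 0" using \<sigma> m b by simp
    show "g w - \<sigma> * b = \<sigma> * m * (1 - b) * (w\<^sup>2 + 2)\<^sup>2 / quartic m n w" if "quartic m n w \<noteq> 0" for w
      using g_minus[OF that, of "\<sigma> * b"] by (simp only: quartic_b)
  qed
  then show ?thesis by simp
qed

text \<open>
  The exceptional values are those for which the quartic equation \<open>g = c\<close> degenerates, \<open>\<mu> = 0\<close> or
  \<open>\<nu> = 0\<close>, or acquires double roots, \<open>\<nu> = 4 \<mu>\<close>.
\<close>

lemma simple_root_Fin:
  assumes "c \<noteq> \<sigma>" "c \<noteq> \<sigma> * a" "c \<noteq> \<sigma> * b"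
  shows "\<exists>z\<in>roots_on S g (Fin c). root_multiplicity g (Fin c) z = 1"
proof -
  let ?\<mu> = "m * (\<sigma> - c)" and ?\<nu> = "n * (\<sigma> * a - c)"
  have \<mu>: "?\<mu> \<noteq> 0" and \<nu>: "?\<nu> \<noteq> 0" using m n assms by auto
  have \<nu>\<mu>: "?\<nu> \<noteq> 4 * ?\<mu>"
  proof
    assume "?\<nu> = 4 * ?\<mu>"
    moreover have "(n - 4 * m) * (\<sigma> * b - c) =
        (?\<nu> - 4 * ?\<mu>) - \<sigma> * (n * (a - b) - 4 * m * (1 - b))"
      by (simp add: algebra_simps)
    ultimately have "(n - 4 * m) * (\<sigma> * b - c) = 0" using nm by simp
    then show False using n4m assms(3) by simp
  qed
  obtain z where z: "quartic ?\<mu> ?\<nu> z = 0" using quartic_root_exists[OF \<mu>] by blast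
  have zS: "z \<in> roots_on S g (Fin c)"
    using z quartic_root_in_domain[OF z \<mu> \<nu>] unfolding roots_on_Fin by (simp add: S_def)
  then have "quartic m n z \<noteq> 0" by (auto simp: roots_on_def sphere_value_g split: if_splits)
  then have "zorder (\<lambda>w. g w - c) z = 1"
    by (rule zorder_quotient_simple_zero[OF z \<mu> \<nu> \<nu>\<mu>, where c = 1]) (simp_all add: g_minus)
  then show ?thesis using zS by (intro bexI[of _ z]) simp_all
qed

lemma simple_pole: "\<exists>z\<in>roots_on S g Infty. root_multiplicity g Infty z = 1"
proof -
  obtain z where z: "quartic m n z = 0" using quartic_root_exists[OF m] by blast
  have "z \<in> roots_on S g Infty"
    using z quartic_root_in_domain[OF z m n] by (simp add: roots_on_def sphere_value_g S_def)
  moreover have "quartic m (n * a) z \<noteq> 0"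
    using quartic_no_common_root[OF m, of n "n * a" z] n a z by auto
  then have "zorder g z = - 1"
    unfolding g_def by (rule zorder_quotient_simple_pole[OF z m n n4m _ \<sigma>])
  ultimately show ?thesis by (intro bexI[of _ z]) simp_all
qed

lemma totally_ramified_values_g:
  "totally_ramified_values S g = {Fin \<sigma>, Fin (\<sigma> * a), Fin (\<sigma> * b)}"
proof (intro equalityI subsetI)
  fix \<alpha> assume \<alpha>: "\<alpha> \<in> totally_ramified_values S g"
  show "\<alpha> \<in> {Fin \<sigma>, Fin (\<sigma> * a), Fin (\<sigma> * b)}"
  proof (cases \<alpha>)
    case (Fin c)
    then show ?thesis using simple_root_Fin[of c] \<alpha> by (force simp: totally_ramified_values_def simp del: root_multiplicity.simps)
  next
    case Infty
    then show ?thesis using simple_pole \<alpha> by (force simp: totally_ramified_values_def simp del: root_multiplicity.simps)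
  qed
next
  fix \<alpha> assume "\<alpha> \<in> {Fin \<sigma>, Fin (\<sigma> * a), Fin (\<sigma> * b)}"
  then show "\<alpha> \<in> totally_ramified_values S g"
    using root_multiplicity_b
    by (auto simp: totally_ramified_values_def roots_on_omitted roots_on_b simp del: root_multiplicity.simps)
qed

text \<open>
  Two omitted values of weight \<open>1\<close> and one value of order \<open>2\<close>.
\<close>

lemma total_weight_g: "total_weight S g = 5 / 2"
proof -
  have "ramification_order S g (Fin \<sigma>) = \<infinity>" "ramification_order S g (Fin (\<sigma> * a)) = \<infinity>"
    by (simp_all add: ramification_order_def roots_on_omitted top_enat_def)
  moreover have "ramification_order S g (Fin (\<sigma> * b)) = enat 2"
  proof -
    have "(\<lambda>z. enat (root_multiplicity g (Fin (\<sigma> * b)) z)) ` {z. z\<^sup>2 = - 2} = (\<lambda>z. enat 2) ` {z. z\<^sup>2 = (- 2 :: complex)}"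
      by (rule image_cong[OF refl]) (simp add: root_multiplicity_b del: root_multiplicity.simps)
    moreover have "csqrt (- 2) \<in> {z. z\<^sup>2 = - 2}" by (simp only: mem_Collect_eq power2_csqrt)
    ultimately show ?thesis
      unfolding ramification_order_def roots_on_b by (metis INF_const empty_iff)
  qed
  moreover have "Fin \<sigma> \<noteq> Fin (\<sigma> * a)" "Fin \<sigma> \<noteq> Fin (\<sigma> * b)" "Fin (\<sigma> * a) \<noteq> Fin (\<sigma> * b)"
    using \<sigma> a b ab by auto
  ultimately show ?thesis
    by (simp add: total_weight_def totally_ramified_values_g)
qed

end

section \<open>Periods and growth\<close>

text \<open>
  \<open>null_vector\<close> is a quadratic map; the coefficient of \<open>U V\<close> is its polarisation.
\<close>

lemma null_vector_linear_combination:
  "null_vector (m * U + n * V) (m' * U + n' * V) i =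
     U\<^sup>2 * null_vector m m' i + U * V * (null_vector (m + n) (m' + n') i - null_vector m m' i - null_vector n n' i)
     + V\<^sup>2 * null_vector n n' i"
proof -
  have "\<forall>i. null_vector (m * U + n * V) (m' * U + n' * V) i =
     U\<^sup>2 * null_vector m m' i + U * V * (null_vector (m + n) (m' + n') i - null_vector m m' i - null_vector n n' i)
     + V\<^sup>2 * null_vector n n' i"
    unfolding forall_3 null_vector_simps by (simp add: power2_eq_square algebra_simps)
  then show ?thesis by blast
qed

text \<open>
  The second and third components are purely imaginary because \<open>\<sigma>\<^sup>2\<close> is real and \<open>\<sigma>\<close> is imaginary.
  For the first component the expression equals \<open>m/2 ((5 m - 4 n) - \<sigma>\<^sup>2 (5 m - 4 n a))\<close>; this is where the
  prescribed value of \<open>\<sigma>\<^sup>2\<close> comes from.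
\<close>

lemma residue_condition:
  fixes m n a c :: real and \<sigma> :: complex
  assumes \<sigma>: "\<sigma>\<^sup>2 = of_real c" "Re \<sigma> = 0" and c: "c * (5 * m - 4 * (n * a)) = 5 * m - 4 * n"
  shows "Re (5 / 2 * null_vector m (\<sigma> * m) i -
    (null_vector (m + n) (\<sigma> * m + \<sigma> * (n * a)) i - null_vector m (\<sigma> * m) i - null_vector n (\<sigma> * (n * a)) i)) = 0"
proof -
  have s2: "(\<sigma> * x)\<^sup>2 = of_real c * x\<^sup>2" for x by (simp add: power_mult_distrib \<sigma>)
  have sum: "\<sigma> * m + \<sigma> * (n * a) = \<sigma> * of_real (m + n * a)" by (simp add: distrib_left)
  have "\<forall>i. Re (5 / 2 * null_vector m (\<sigma> * m) i -
    (null_vector (m + n) (\<sigma> * of_real (m + n * a)) i - null_vector m (\<sigma> * of_real m) i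
      - null_vector n (\<sigma> * of_real (n * a)) i)) = 0"
    unfolding forall_3 null_vector_simps s2
  proof (intro conjI)
    have "Re (5 / 2 * ((of_real m)\<^sup>2 - of_real c * (of_real m)\<^sup>2) -
        ((of_real (m + n))\<^sup>2 - of_real c * (of_real (m + n * a))\<^sup>2 - ((of_real m)\<^sup>2 - of_real c * (of_real m)\<^sup>2)
          - ((of_real n)\<^sup>2 - of_real c * (of_real (n * a))\<^sup>2))) =
        5 / 2 * (m\<^sup>2 - c * m\<^sup>2) - ((m + n)\<^sup>2 - c * (m + n * a)\<^sup>2 - (m\<^sup>2 - c * m\<^sup>2) - (n\<^sup>2 - c * (n * a)\<^sup>2))"
      by (simp flip: of_real_power of_real_mult of_real_add)
    also have "\<dots> = m / 2 * ((5 * m - 4 * n) - c * (5 * m - 4 * (n * a)))"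
      by (simp add: power2_eq_square algebra_simps)
    also have "\<dots> = 0" using c by simp
    finally show "Re (5 / 2 * ((of_real m)\<^sup>2 - of_real c * (of_real m)\<^sup>2) -
        ((of_real (m + n))\<^sup>2 - of_real c * (of_real (m + n * a))\<^sup>2 - ((of_real m)\<^sup>2 - of_real c * (of_real m)\<^sup>2)
          - ((of_real n)\<^sup>2 - of_real c * (of_real (n * a))\<^sup>2))) = 0" .
  qed (simp_all add: \<sigma>(2) flip: of_real_power of_real_mult of_real_add of_real_diff)
  then show ?thesis unfolding sum by blast
qed

text \<open>
  Solving the two linear equations for \<open>U = z\<^sup>4\<close> and \<open>V = z\<^sup>2 + 1\<close> bounds \<open>|U| + |V|\<close> by a multiple of
  \<open>|p| + |q|\<close>.  In turn \<open>(1 + t)\<^sup>2 \<le> 4 (t\<^sup>2 + |1 - t|)\<close> with \<open>t = |z|\<^sup>2\<close> shows that \<open>|U| + |V|\<close> grows like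
  \<open>|z|\<^sup>4\<close> and has no zero.
\<close>

lemma quartic_pair_growth:
  assumes m: "m \<noteq> 0" and n: "n \<noteq> 0" and a: "a \<noteq> 1" and \<sigma>: "\<sigma> \<noteq> 0"
  shows "\<exists>C>0. \<forall>z. (1 + (cmod z)\<^sup>2) ^ 4 \<le> C * spinor_norm (quartic m n z) (\<sigma> * quartic m (n * a) z)"
proof -
  define k where "k = max (max ((1 / cmod \<sigma>) / cmod (m * (1 - a))) (cmod a / cmod (m * (1 - a))))
    (max ((1 / cmod \<sigma>) / cmod (n * (1 - a))) (1 / cmod (n * (1 - a))))"
  have k: "k > 0" using n a by (simp add: k_def less_max_iff_disj)
  have "(1 + (cmod z)\<^sup>2) ^ 4 \<le> (128 * k\<^sup>2) * spinor_norm (quartic m n z) (\<sigma> * quartic m (n * a) z)" for z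
  proof -
    define P Q where "P = quartic m n z" and "Q = \<sigma> * quartic m (n * a) z"
    define U V where "U = z ^ 4" and "V = z\<^sup>2 + 1"
    have PU: "P = m * U + n * V" "Q / \<sigma> = m * U + n * a * V"
      using \<sigma> by (simp_all add: P_def Q_def U_def V_def quartic_def)
    have tri: "cmod (x - y) \<le> cmod x + cmod y" for x y :: complex by (rule norm_triangle_ineq4)
    have "U = (Q / \<sigma> - a * P) / (m * (1 - a))"
      unfolding PU using m a by (simp add: field_simps)
    then have "cmod U \<le> (cmod Q / cmod \<sigma> + cmod a * cmod P) / cmod (m * (1 - a))"
      using tri[of "Q / \<sigma>" "a * P"] by (simp add: norm_divide norm_mult divide_right_mono)
    also have "\<dots> = cmod Q * ((1 / cmod \<sigma>) / cmod (m * (1 - a))) + cmod P * (cmod a / cmod (m * (1 - a)))"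
      by (simp add: add_divide_distrib mult_ac)
    also have "\<dots> \<le> cmod Q * k + cmod P * k"
      by (intro add_mono mult_left_mono) (simp_all add: k_def)
    finally have U: "cmod U \<le> k * (cmod P + cmod Q)" by (simp add: algebra_simps)
    have "V = (P - Q / \<sigma>) / (n * (1 - a))"
      unfolding PU using n a by (simp add: field_simps)
    then have "cmod V \<le> (cmod P + cmod Q / cmod \<sigma>) / cmod (n * (1 - a))"
      using tri[of P "Q / \<sigma>"] by (simp add: norm_divide norm_mult divide_right_mono)
    also have "\<dots> = cmod Q * ((1 / cmod \<sigma>) / cmod (n * (1 - a))) + cmod P * (1 / cmod (n * (1 - a)))"
      by (simp add: add_divide_distrib mult_ac)
    also have "\<dots> \<le> cmod Q * k + cmod P * k"
      by (intro add_mono mult_left_mono) (simp_all add: k_def)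
    finally have V: "cmod V \<le> k * (cmod P + cmod Q)" by (simp add: algebra_simps)
    define t where "t = (cmod z)\<^sup>2"
    have t: "t \<ge> 0" by (simp add: t_def)
    have tU: "cmod U = t\<^sup>2" by (simp add: U_def t_def norm_power)
    have tV: "\<bar>1 - t\<bar> \<le> cmod V"
      using norm_triangle_ineq3[of "1 :: complex" "- z\<^sup>2"] by (simp add: V_def t_def norm_power add.commute)
    have "(1 + t)\<^sup>2 \<le> 4 * (t\<^sup>2 + \<bar>1 - t\<bar>)"
    proof (cases "t \<le> 1")
      case True
      have "0 \<le> 3 * (t - 1)\<^sup>2" by simp
      then show ?thesis using True by (simp add: power2_eq_square algebra_simps)
    next
      case False
      then have "1 * 1 \<le> t * t" by (intro mult_mono) auto
      then show ?thesis using False by (simp add: power2_eq_square algebra_simps)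
    qed
    also have "\<dots> \<le> 4 * (cmod U + cmod V)" using tU tV by simp
    also have "\<dots> \<le> 4 * (k * (cmod P + cmod Q) + k * (cmod P + cmod Q))"
      by (intro mult_left_mono add_mono U V) simp
    finally have "(1 + t)\<^sup>2 \<le> 8 * k * (cmod P + cmod Q)" by (simp add: algebra_simps)
    then have "((1 + t)\<^sup>2)\<^sup>2 \<le> (8 * k * (cmod P + cmod Q))\<^sup>2"
      by (rule power_mono) simp
    also have "\<dots> = 64 * k\<^sup>2 * (cmod P + cmod Q)\<^sup>2" by (simp add: power_mult_distrib)
    also have "(cmod P + cmod Q)\<^sup>2 \<le> 2 * spinor_norm P Q"
      using zero_le_power2[of "cmod P - cmod Q"] by (simp add: spinor_norm_def power2_eq_square algebra_simps)
    finally show ?thesis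
      by (simp add: P_def Q_def t_def mult_left_mono flip: power_mult)
  qed
  then show ?thesis using k by (intro exI[of _ "128 * k\<^sup>2"]) auto
qed

lemma norm_square_add_le: "(cmod (z - c))\<^sup>2 \<le> 2 * (1 + (cmod z)\<^sup>2)" if "cmod c \<le> 1"
proof -
  have "cmod (z - c) \<le> cmod z + 1" using norm_triangle_ineq4[of z c] that by linarith
  then have "(cmod (z - c))\<^sup>2 \<le> (cmod z + 1)\<^sup>2" by (rule power_mono) simp
  also have "\<dots> \<le> 2 * (1 + (cmod z)\<^sup>2)"
    using zero_le_power2[of "cmod z - 1"] by (simp add: power2_eq_square algebra_simps)
  finally show ?thesis .
qed

lemma compact_away_from_punctures:
  fixes S A :: "complex set"
  assumes S: "S = - A"
  shows "compact {z\<in>S. cmod z \<le> M \<and> (\<forall>c\<in>A. cmod (1 / (z - c)) \<le> K c)}"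
proof -
  have "cmod (1 / (z - c)) \<le> K c \<longleftrightarrow> 1 \<le> K c * cmod (z - c)" if "z \<noteq> c" for z c
    using that by (simp add: norm_divide divide_simps)
  then have "z \<notin> A \<and> (\<forall>c\<in>A. cmod (1 / (z - c)) \<le> K c) \<longleftrightarrow> (\<forall>c\<in>A. 1 \<le> K c * cmod (z - c))" for z
    by (metis eq_iff_diff_eq_0 mult_zero_right norm_zero not_one_le_zero)
  then have "{z\<in>S. cmod z \<le> M \<and> (\<forall>c\<in>A. cmod (1 / (z - c)) \<le> K c)} =
      cball 0 M \<inter> (\<Inter>c\<in>A. {z. 1 \<le> K c * cmod (z - c)})"
    unfolding S by (intro set_eqI) (simp only: mem_Collect_eq Int_iff INT_iff mem_cball_0 Compl_iff, blast)
  moreover have "closed (\<Inter>c\<in>A. {z. 1 \<le> K c * cmod (z - c)})"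
    by (intro closed_INT ballI closed_Collect_le continuous_intros)
  ultimately show ?thesis by (simp add: compact_Int_closed)
qed

section \<open>The surface\<close>

theorem theorem3p7:
  fixes a b :: real and \<sigma> :: complex and S :: "complex set" and g h :: "complex \<Rightarrow> complex"
  assumes "a \<noteq> 1" and "b \<noteq> 1" and "a \<noteq> b"
    and "\<sigma>\<^sup>2 = complex_of_real ((5 * a + 11 * b - 16) / (16 * a * b - 11 * a - 5 * b))"
    and "(5 * a + 11 * b - 16) / (16 * a * b - 11 * a - 5 * b) < 0"
    and "S = UNIV - {0, \<i>, - \<i>}"
    and "g = (\<lambda>z. \<sigma> *
      ((of_real (b - a) * z ^ 4 + of_real (4 * a * (b - 1)) * z\<^sup>2 + of_real (4 * a * (b - 1))) /
       (of_real (b - a) * z ^ 4 + of_real (4 * (b - 1)) * z\<^sup>2 + of_real (4 * (b - 1)))))"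
    and "h = (\<lambda>z.
      (of_real (b - a) * z ^ 4 + of_real (4 * (b - 1)) * z\<^sup>2 + of_real (4 * (b - 1)))\<^sup>2 /
      (z\<^sup>2 * (z\<^sup>2 + 1)\<^sup>2))"
  shows "(\<exists>X :: complex \<Rightarrow> real ^ 3.
            minimal_surface S X \<and> complete_surface S X \<and> weierstrass_data S g h X \<and>
            finite_total_curvature S X \<and>
            (\<forall>z\<in>S. gauss_map X z = sphere_value g z)) \<and>
         finite (totally_ramified_values S g) \<and>
         total_weight S g = 5 / 2"
proof -
  \<comment> \<open>These make \<open>p\<close> and \<open>q\<close> members of the pencil \<open>quartic m\<close>.\<close>
  define m n :: real where "m = b - a" and "n = 4 * (b - 1)"
  define c where "c = (5 * a + 11 * b - 16) / (16 * a * b - 11 * a - 5 * b)"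
  have c: "c < 0" "\<sigma>\<^sup>2 = of_real c" using assms(4,5) by (simp_all add: c_def)
  have \<sigma>: "\<sigma> \<noteq> 0" using c by auto
  have Re_\<sigma>: "Re \<sigma> = 0"
  proof (rule ccontr)
    assume r: "Re \<sigma> \<noteq> 0"
    have "Re \<sigma> * Im \<sigma> = 0" "(Re \<sigma>)\<^sup>2 - (Im \<sigma>)\<^sup>2 = c"
      using arg_cong[OF c(2), of Im] arg_cong[OF c(2), of Re] by (auto simp: power2_eq_square)
    then have "(Re \<sigma>)\<^sup>2 = c" using r by auto
    then show False using c(1) by (metis not_le zero_le_power2)
  qed
  have mn: "m \<noteq> 0" "n \<noteq> 0" "n \<noteq> 4 * m" "n * (a - b) = 4 * m * (1 - b)"
    using assms(1-3) by (simp_all add: m_def n_def algebra_simps)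
  have "complex_of_real (n * (a - b)) = of_real (4 * m * (1 - b))" "complex_of_real n \<noteq> of_real (4 * m)"
    unfolding of_real_eq_iff by (rule mn)+
  then have cplx: "complex_of_real m \<noteq> 0" "complex_of_real n \<noteq> 0" "complex_of_real n \<noteq> 4 * of_real m"
    "complex_of_real a \<noteq> 1" "complex_of_real b \<noteq> 1" "complex_of_real a \<noteq> of_real b" "\<sigma> \<noteq> 0"
    "complex_of_real n * (of_real a - of_real b) = 4 * of_real m * (1 - of_real b)"
    using mn(1,2) assms(1-3) \<sigma> by simp_all
  have period: "c * (5 * m - 4 * (n * a)) = 5 * m - 4 * n"
  proof -
    define d e where "d = 16 * a * b - 11 * a - 5 * b" and "e = 5 * a + 11 * b - 16"
    have "5 * m - 4 * (n * a) = - d" "5 * m - 4 * n = - e"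
      by (simp_all add: m_def n_def d_def e_def algebra_simps)
    moreover have "d \<noteq> 0" "c = e / d" using assms(5) by (auto simp: c_def d_def e_def)
    ultimately show ?thesis by simp
  qed
  define p q s where "p = quartic m n" and "q = (\<lambda>z. \<sigma> * quartic m (complex_of_real n * a) z)"
    and "s = (\<lambda>z::complex. 1 / (z\<^sup>2 * (z\<^sup>2 + 1)\<^sup>2))"
  have p_poly: "of_real (b - a) * z ^ 4 + of_real (4 * (b - 1)) * z\<^sup>2 + of_real (4 * (b - 1)) = p z" for z
    by (simp add: p_def quartic_def m_def n_def algebra_simps)
  have q_poly: "\<sigma> * (of_real (b - a) * z ^ 4 + of_real (4 * a * (b - 1)) * z\<^sup>2 + of_real (4 * a * (b - 1))) = q z" for z
    by (simp add: q_def quartic_def m_def n_def algebra_simps)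
  have g: "g = (\<lambda>z. q z / p z)"
    unfolding assms(7) p_poly q_poly[symmetric] by simp
  have h: "h = (\<lambda>z. s z * (p z)\<^sup>2)"
    unfolding assms(8) p_poly s_def by simp
  have S: "S = - {0, \<i>, - \<i>}" using assms(6) by auto
  have open_S: "open S" unfolding S by (intro open_Compl finite_imp_closed) simp
  have p_ev: "\<forall>\<^sub>F w in at z. p w \<noteq> 0" for z
    unfolding p_def using cplx by (intro eventually_quartic_nonzero) simp_all
  have pq: "p z \<noteq> 0 \<or> q z \<noteq> 0" for z
    using quartic_no_common_root[of m n "complex_of_real n * a" z] cplx by (auto simp: p_def q_def)
  \<comment> \<open>The coefficients of \<open>z\<^sup>8\<close>, \<open>z\<^sup>4 (z\<^sup>2 + 1)\<close> and \<open>(z\<^sup>2 + 1)\<^sup>2\<close> in \<open>null_vector (p z) (q z) i\<close>.\<close>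
  define x y w where "x i = null_vector m (\<sigma> * m) i"
    and "y i = null_vector (m + n) (\<sigma> * m + \<sigma> * (n * a)) i - null_vector m (\<sigma> * m) i - null_vector n (\<sigma> * (n * a)) i"
    and "w i = null_vector n (\<sigma> * (n * a)) i" for i
  define X :: "complex \<Rightarrow> real ^ 3" where "X z = (\<chi> i. primitive_part (x i) (y i) (w i) z)" for z
  have X_derivative: "(X has_derivative (\<lambda>v. re_vec (\<lambda>i. v * spinor_form p q s i z))) (at z)"
    if z: "z \<in> S" for z
  proof (rule has_derivative_vec3)
    fix i
    have nz: "z \<noteq> 0" "z \<noteq> \<i>" "z \<noteq> - \<i>" using z by (auto simp: S)
    then have T: "z\<^sup>2 + 1 \<noteq> 0" by (simp add: square_plus_one_eq_0_iff)
    have "p z = m * z ^ 4 + n * (z\<^sup>2 + 1)" "q z = (\<sigma> * m) * z ^ 4 + (\<sigma> * (n * a)) * (z\<^sup>2 + 1)"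
      by (simp_all add: p_def q_def quartic_def algebra_simps)
    then have null: "null_vector (p z) (q z) i = (z ^ 4)\<^sup>2 * x i + z ^ 4 * (z\<^sup>2 + 1) * y i + (z\<^sup>2 + 1)\<^sup>2 * w i"
      unfolding x_def y_def w_def by (simp only: null_vector_linear_combination of_real_add)
    have z4: "z ^ 4 = z\<^sup>2 * z\<^sup>2" and z6: "z ^ 6 = (z\<^sup>2) ^ 3" by (simp_all flip: power_mult power_add)
    have expand: "1 / (A * T\<^sup>2) * ((A * A)\<^sup>2 * x' + A * A * T * y' + T\<^sup>2 * w') =
        x' * (A ^ 3 / T\<^sup>2) + y' * (A / T) + w' / A" if "A \<noteq> 0" "T \<noteq> 0" for A T x' y' w' :: complex
      using that by (simp add: field_simps power2_eq_square power3_eq_cube)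
    have "spinor_form p q s i z =
        x i * (z ^ 6 / (z\<^sup>2 + 1)\<^sup>2) + y i * (z\<^sup>2 / (z\<^sup>2 + 1)) + w i / z\<^sup>2"
      unfolding spinor_form_def s_def null z4 z6 by (rule expand) (use nz(1) T in simp_all)
    moreover have "Re (5 / 2 * x i - y i) = 0"
      unfolding x_def y_def by (rule residue_condition[OF c(2) Re_\<sigma> period])
    ultimately show "((\<lambda>z. X z $ i) has_derivative (\<lambda>v. re_vec (\<lambda>i. v * spinor_form p q s i z) $ i)) (at z)"
      using has_derivative_primitive_part[OF nz, of "x i" "y i" "w i"] by (simp only: re_vec_nth X_def vec_lambda_beta)
  qed
  interpret spinor_surface S p q s X
  proof
    show "connected S"
      unfolding assms(6)
      by (rule connected_open_delete_finite) (auto intro: convex_connected)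
    show "s holomorphic_on S"
      unfolding s_def by (intro holomorphic_intros) (auto simp: S square_plus_one_eq_0_iff)
    show "s z \<noteq> 0" if "z \<in> S" for z
      using that by (auto simp: S s_def square_plus_one_eq_0_iff)
  qed (use open_S pq X_derivative in \<open>auto simp: p_def q_def intro!: holomorphic_intros\<close>)
  obtain C where C: "C > 0" "\<And>z. (1 + (cmod z)\<^sup>2) ^ 4 \<le> C * N z"
    using quartic_pair_growth[of m n a \<sigma>] cplx by (auto simp: p_def q_def)
  have complete: "complete_surface S X"
  proof -
    define A :: "complex set" where "A = {0, \<i>, - \<i>}"
    \<comment> \<open>\<open>None\<close> stands for the puncture at infinity.\<close>
    define f f' :: "complex option \<Rightarrow> complex \<Rightarrow> complex"
      where "f j z = (case j of None \<Rightarrow> z | Some c \<Rightarrow> 1 / (z - c))"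
        and "f' j z = (case j of None \<Rightarrow> 1 | Some c \<Rightarrow> - 1 / (z - c)\<^sup>2)" for j z
    have zA: "z \<noteq> c" if "z \<in> S" "c \<in> A" for z c using that by (auto simp: S A_def)
    have dist: "(cmod (z - c))\<^sup>2 \<le> 2 * (1 + (cmod z)\<^sup>2)" if "c \<in> A" for z c
      using that by (intro norm_square_add_le) (auto simp: A_def)
    show ?thesis
    proof (rule complete_surface_if_dominated_exhaustion[of "8 * C" "insert None (Some ` A)" f f'])
      show "8 * C > 0" using C(1) by simp
      show "(f j has_field_derivative f' j z) (at z)" if "j \<in> insert None (Some ` A)" "z \<in> S" for j z
        using that zA[of z] unfolding f_def[abs_def] f'_def
        by (auto intro!: derivative_eq_intros simp: power2_eq_square)
      show "continuous_on S (f' j)" if "j \<in> insert None (Some ` A)" for j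
        using that zA unfolding f'_def[abs_def] by (auto intro!: continuous_intros)
      show "cmod (f' j z) \<le> 8 * C * (cmod (s z) * N z)" if j: "j \<in> insert None (Some ` A)" and z: "z \<in> S" for j z
      proof -
        define t where "t = 1 + (cmod z)\<^sup>2"
        have t: "t \<ge> 1" by (simp add: t_def)
        \<comment> \<open>The denominator of \<open>|s|\<close> is \<open>D 0 * D \<i> * D (-\<i>)\<close>, and \<open>1 / D c\<close> is the modulus of \<open>f' (Some c)\<close>:
          multiplying by the former leaves two or three factors, each at most \<open>2 t\<close>, and \<open>t \<ge> 1\<close>.\<close>
        define D where "D c = (cmod (z - c))\<^sup>2" for c
        have D: "0 < D c" "D c \<le> 2 * t" if "c \<in> A" for c
          using dist[OF that, of z] zA[OF z that] by (auto simp: D_def t_def)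
        have D': "0 < D 0" "0 < D \<i>" "0 < D (- \<i>)" "D 0 \<le> 2 * t" "D \<i> \<le> 2 * t" "D (- \<i>) \<le> 2 * t"
          using D by (auto simp: A_def)
        have "z\<^sup>2 + 1 = (z - \<i>) * (z - (- \<i>))" by (simp add: power2_eq_square algebra_simps)
        then have s: "cmod (s z) = 1 / (D 0 * D \<i> * D (- \<i>))"
          by (simp only: s_def D_def norm_divide norm_mult norm_power norm_one diff_zero power_mult_distrib mult.assoc)
        have t2: "(2 * t) * (2 * t) \<le> 8 * t ^ 4" "(2 * t) * (2 * t) * (2 * t) \<le> 8 * t ^ 4"
        proof -
          have "t ^ 2 \<le> t ^ 4" "t ^ 3 \<le> t ^ 4" using t by (auto intro: power_increasing)
          moreover have "0 \<le> t ^ 4" using t by simp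
          ultimately have "4 * t ^ 2 \<le> 8 * t ^ 4" "8 * t ^ 3 \<le> 8 * t ^ 4" by linarith+
          then show "(2 * t) * (2 * t) \<le> 8 * t ^ 4" "(2 * t) * (2 * t) * (2 * t) \<le> 8 * t ^ 4"
            by (simp_all add: power2_eq_square power3_eq_cube mult_ac)
        qed
        have "cmod (f' j z) * (D 0 * D \<i> * D (- \<i>)) \<le> 8 * t ^ 4"
        proof (cases j)
          case None
          have "D 0 * D \<i> * D (- \<i>) \<le> (2 * t) * (2 * t) * (2 * t)"
            using D' t by (intro mult_mono) auto
          then show ?thesis using t2 None by (simp add: f'_def)
        next
          case (Some c)
          then have cA: "c \<in> A" using j by auto
          have f': "cmod (f' j z) = 1 / D c"
            by (simp add: Some f'_def D_def norm_divide norm_power)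
          have two: "u * v \<le> 8 * t ^ 4" if "0 < u" "0 < v" "u \<le> 2 * t" "v \<le> 2 * t" for u v
          proof -
            have "u * v \<le> (2 * t) * (2 * t)" using that t by (intro mult_mono) auto
            then show ?thesis using t2(1) by linarith
          qed
          from cA consider "c = 0" | "c = \<i>" | "c = - \<i>" by (auto simp: A_def)
          then show ?thesis
          proof cases
            case 1
            then show ?thesis using two[of "D \<i>" "D (- \<i>)"] D' by (simp add: f')
          next
            case 2
            then show ?thesis using two[of "D 0" "D (- \<i>)"] D' by (simp add: f')
          next
            case 3
            then show ?thesis using two[of "D 0" "D \<i>"] D' by (simp add: f')
          qed
        qed
        also have "\<dots> \<le> 8 * (C * N z)" using C(2)[of z] by (simp add: t_def)
        finally show ?thesis
          unfolding s using D' by (simp add: divide_simps mult_ac)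
      qed
      fix M :: "complex option \<Rightarrow> real"
      have "{z \<in> S. \<forall>j\<in>insert None (Some ` A). cmod (f j z) \<le> M j} =
          {z \<in> S. cmod z \<le> M None \<and> (\<forall>c\<in>A. cmod (1 / (z - c)) \<le> (M \<circ> Some) c)}"
        by (simp add: f_def)
      then show "compact {z \<in> S. \<forall>j\<in>insert None (Some ` A). cmod (f j z) \<le> M j}"
        using compact_away_from_punctures[of S A "M None" "M \<circ> Some"] by (simp only: S A_def)
    qed
  qed
  have curvature: "finite_total_curvature S X"
  proof (rule finite_total_curvature_if_bounded)
    define k where "k = cmod (2 * \<sigma> * m * n * (a - 1))"
    \<comment> \<open>The terms of degree 7 of the Wronskian cancel, so that it has degree 5 only.\<close>
    let ?W = "\<lambda>z. 2 * \<sigma> * m * n * (a - 1) * (z ^ 3 * (z\<^sup>2 + 2)) :: complex"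
    show "continuous_on UNIV ?W" by (intro continuous_intros)
    show "continuous_on UNIV p" "continuous_on UNIV q"
      unfolding p_def q_def by (intro continuous_intros continuous_quartic)+
    show "p z \<noteq> 0 \<or> q z \<noteq> 0" for z by (rule pq)
    show "deriv p z * q z - p z * deriv q z = ?W z" for z
    proof -
      have "deriv p z = 4 * complex_of_real m * z ^ 3 + 2 * complex_of_real n * z"
        unfolding p_def by (rule DERIV_imp_deriv[OF has_field_derivative_quartic])
      moreover have "deriv q z = \<sigma> * (4 * complex_of_real m * z ^ 3 + 2 * (complex_of_real n * a) * z)"
        unfolding q_def by (rule DERIV_imp_deriv) (rule DERIV_cmult[OF has_field_derivative_quartic])
      ultimately show ?thesis
        by (simp add: p_def q_def quartic_def power2_eq_square power3_eq_cube power4_eq_xxxx algebra_simps)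
    qed
    show "cmod (?W z) / N z \<le> 2 * k * C / (1 + (cmod z)\<^sup>2)" for z
    proof -
      define t where "t = 1 + (cmod z)\<^sup>2"
      have t: "t \<ge> 1" by (simp add: t_def)
      have "2 * cmod z \<le> t"
        using zero_le_power2[of "cmod z - 1"] by (simp add: t_def power2_eq_square algebra_simps)
      then have "cmod z \<le> t" using norm_ge_zero[of z] by linarith
      then have "cmod z * (cmod z)\<^sup>2 \<le> t * t" by (intro mult_mono) (auto simp: t_def)
      moreover have "cmod (z\<^sup>2 + 2) \<le> t + 1"
        using norm_triangle_ineq[of "z\<^sup>2" 2] by (simp add: t_def norm_power)
      then have "cmod (z\<^sup>2 + 2) \<le> 2 * t" using t by linarith
      ultimately have "cmod (z ^ 3 * (z\<^sup>2 + 2)) \<le> (t * t) * (2 * t)"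
        unfolding norm_mult using t by (intro mult_mono) (auto simp: norm_mult power2_eq_square power3_eq_cube mult_ac)
      then have "cmod (?W z) \<le> k * ((t * t) * (2 * t))"
        unfolding norm_mult[of _ "z ^ 3 * _"] k_def[symmetric] by (intro mult_left_mono) (auto simp: k_def)
      then have "cmod (?W z) * t \<le> 2 * k * t ^ 4"
        using t by (simp add: power4_eq_xxxx mult_ac)
      also have "\<dots> \<le> 2 * k * (C * N z)"
        using C(2)[of z] by (intro mult_left_mono) (auto simp: t_def k_def)
      finally show ?thesis
        using spinor_norm_pos[OF pq[of z]] t unfolding t_def[symmetric] by (simp add: divide_simps mult_ac)
    qed
  qed
  have g_frac: "g = (\<lambda>z. \<sigma> * quartic m (complex_of_real n * a) z / quartic m n z)"
    unfolding g p_def q_def by simp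
  note ramified = cplx assms(6) g_frac
  have "finite (totally_ramified_values S g)"
    unfolding totally_ramified_values_g[OF ramified] by simp
  moreover have "total_weight S g = 5 / 2"
    by (rule total_weight_g[OF ramified])
  moreover have "S \<noteq> {}" unfolding S using infinite_UNIV_char_0 by (metis Compl_empty_eq double_compl finite.emptyI finite_insert)
  ultimately show ?thesis
    using minimal_surface_X complete weierstrass_data_X[OF p_ev] curvature gauss_map_X_sphere_value[OF _ p_ev]
    unfolding g h by blast
qed

end
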